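(* Let $K$ be an infinite field, let $G$ be any graph, and let $G_1,\ldots,G_t$ be the connected components of $G$. Then $$\ell(J_G)=\sum_{i=1}^t \ell(J_{G_i}).$$
   Context: All graphs are finite and simple. For a graph $H$ with vertex set $V(H)$ and edge set $E(H)$ (vertices are positive integers), the binomial edge ideal of $H$ is $J_H=(x_iy_j-x_jy_i \mid \{i,j\}\in E(H))\subset K[x_v,y_v \mid v\in V(H)]$. For a homogeneous ideal $I$ in a polynomial ring $A$ over $K$ with homogeneous maximal ideal $\mathfrak m$ (generated by all the variables of $A$), the Rees algebra is $A[It]=\bigoplus_{k\ge 0} I^k t^k$, the special fiber ring is $F(I)=A[It]/\mathfrak m A[It]$, and the analytic spread is $\ell(I)=\dim F(I)$ (Krull dimension). *)

theory Defs
  imports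
    "HOL-Algebra.Algebra"
    "HOL-Library.Extended_Nat"
    "HOL-Library.Poly_Mapping"
    "Graph_Theory.Graph_Theory"
begin

(* For the zero ring, which has no prime ideals, this supremum is 0. *)
definition krull_dim :: "('a, 'b) ring_scheme \<Rightarrow> enat" where
  "krull_dim R = Sup {enat n | n. \<exists>P. (\<forall>i\<le>n. primeideal (P i) R) \<and> (\<forall>i<n. P i \<subset> P (Suc i))}"

(* Powers in ideals_set R are powers for the product of ideals, with 0-th power carrier R. *)
definition rees_algebra :: "('a, 'b) ring_scheme \<Rightarrow> 'a set \<Rightarrow> ('a, nat \<Rightarrow> 'a) up_ring" where
  "rees_algebra R I =
     UP R\<lparr>carrier := {p \<in> carrier (UP R). \<forall>k. coeff (UP R) p k \<in> I [^]\<^bsub>ideals_set R\<^esub> k}\<rparr>"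

(* The ideal M of R is extended to the Rees algebra by placing its elements in degree 0. *)
definition special_fiber_ring ::
    "('a, 'b) ring_scheme \<Rightarrow> 'a set \<Rightarrow> 'a set \<Rightarrow> (nat \<Rightarrow> 'a) set ring" where
  "special_fiber_ring R M I =
     rees_algebra R I Quot (Idl\<^bsub>rees_algebra R I\<^esub> ((\<lambda>a. monom (UP R) a 0) ` M))"

type_synonym ('x, 'k) mpoly = "('x \<Rightarrow>\<^sub>0 nat) \<Rightarrow>\<^sub>0 'k"

definition mpoly_var :: "'x \<Rightarrow> ('x, 'k::field) mpoly" where
  "mpoly_var x = Poly_Mapping.single (Poly_Mapping.single x 1) 1"

definition mpoly_ring :: "'x set \<Rightarrow> ('x, 'k::field) mpoly ring" where
  "mpoly_ring S =
     \<lparr>carrier = {p. \<forall>m \<in> Poly_Mapping.keys p. Poly_Mapping.keys m \<subseteq> S},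
      monoid.mult = (*), one = 1, ring.zero = 0, add = (+)\<rparr>"

definition irrelevant_ideal :: "'x set \<Rightarrow> ('x, 'k::field) mpoly set" where
  "irrelevant_ideal S = Idl\<^bsub>mpoly_ring S\<^esub> (mpoly_var ` S)"

definition analytic_spread :: "'x set \<Rightarrow> ('x, 'k::field) mpoly set \<Rightarrow> enat" where
  "analytic_spread S I = krull_dim (special_fiber_ring (mpoly_ring S) (irrelevant_ideal S) I)"

datatype 'v bei_var = Xvar 'v | Yvar 'v

definition bei_vars :: "('v, 'e) pre_digraph \<Rightarrow> 'v bei_var set" where
  "bei_vars H = Xvar ` verts H \<union> Yvar ` verts H"

(* An undirected edge {i, j} is represented by the two arcs (i, j) and (j, i);
   their generators differ only by sign. *)
definition binomial_edge_ideal :: "('v, 'e) pre_digraph \<Rightarrow> ('v bei_var, 'k::field) mpoly set" where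
  "binomial_edge_ideal H = Idl\<^bsub>mpoly_ring (bei_vars H)\<^esub>
     {mpoly_var (Xvar i) * mpoly_var (Yvar j) - mpoly_var (Xvar j) * mpoly_var (Yvar i)
      | i j. (i, j) \<in> arcs_ends H}"

definition connected_components :: "('v, 'e) pre_digraph \<Rightarrow> ('v, 'e) pre_digraph set" where
  "connected_components G = {H. pre_digraph.max_subgraph G Digraph_Component.connected H}"

end

theory Submission
  imports Defs "HOL-Computational_Algebra.Polynomial"
begin

text \<open>
  All generators of a binomial edge ideal \<open>J\<close> are quadrics. In such a case the fiber ring is
  isomorphic to the subalgebra \<open>K[F]\<close> of the polynomial ring generated by the set \<open>F\<close> of generators: send an element
  \<open>\<Sum> a\<^sub>k t\<^sup>k\<close> of the Rees algebra to the sum of the components of \<open>a\<^sub>k\<close> of degree \<open>2k\<close>, the lowest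
  degree that occurs in \<open>J\<^sup>k\<close>. Since \<open>J\<^sup>k\<close> is generated by products of \<open>k\<close> elements of \<open>F\<close>, the kernel
  is the extension of the irrelevant ideal (\<open>analytic_spread_eq_krull_dim\<close>).

  It remains to see that the Krull dimension of \<open>K[F]\<close> is additive over disjoint sets of variables. For
  this it is computed as a codimension. Let \<open>F\<close> consist of polynomials in a finite set \<open>V\<close> of variables,
  and let \<open>vs\<close> be a maximal list of variables from \<open>V\<close> that is algebraically independent over \<open>K[F]\<close>.
  Then \<open>dim K[F] = |V| - |vs|\<close> (\<open>krull_dim_subalg\<close>):

  \<^item> For a chain \<open>P\<^sub>0 \<subset> \<dots> \<subset> P\<^sub>n\<close> of primes choose \<open>a\<^sub>i\<close> in \<open>P\<^sub>i\<close> but not in the prime before it. These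
    \<open>n\<close> elements are algebraically independent over \<open>K\<close> (\<open>prime_chain_indep\<close>), and together with \<open>vs\<close>
    they still are. A count of monomials shows that a polynomial ring in \<open>|V|\<close> variables contains no
    more than \<open>|V|\<close> independent elements (\<open>indep_length_le\<close>).

  \<^item> Conversely, each variable outside \<open>vs\<close> satisfies an equation over \<open>K[F][vs]\<close>. As \<open>K\<close> is infinite,
    there is a point of \<open>K\<^sup>V\<close> at which none of the leading coefficients vanishes. Specialise \<open>vs\<close> to
    the coordinates of this point, and then the other variables one after the other. The kernels of
    these substitutions on \<open>K[F]\<close> are primes, and each step makes the kernel larger: a
    substitution \<open>x := c\<close> that is injective on a subring forces \<open>x\<close> to be transcendental over it
    (\<open>transc_if_specialization_inj\<close>), against the specialised equation.

  For disjoint sets of variables, the concatenation of two such maximal lists is again one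
  (\<open>var_basis_Un\<close>), so codimensions add up. Finally, the connected components of a graph partition its
  vertices and its edges, hence the variables and the generators.
\<close>

section \<open>Algebraic independence in commutative rings\<close>

inductive_set ring_gen :: "'a::comm_ring_1 set \<Rightarrow> 'a set" for F where
  base: "x \<in> F \<Longrightarrow> x \<in> ring_gen F"
| one: "1 \<in> ring_gen F"
| uminus: "x \<in> ring_gen F \<Longrightarrow> - x \<in> ring_gen F"
| add: "x \<in> ring_gen F \<Longrightarrow> y \<in> ring_gen F \<Longrightarrow> x + y \<in> ring_gen F"
| mult: "x \<in> ring_gen F \<Longrightarrow> y \<in> ring_gen F \<Longrightarrow> x * y \<in> ring_gen F"

text \<open>
  Almost everything below happens inside one polynomial type, where the algebra of the type classes
  is available; subrings are therefore plain sets there. The passage to record structures, on which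
  ideals and dimensions are defined, is made by \<open>ring_of\<close>.
\<close>

definition is_subring :: "'a::comm_ring_1 set \<Rightarrow> bool" where
  "is_subring S \<longleftrightarrow> 1 \<in> S \<and> (\<forall>x\<in>S. - x \<in> S) \<and> (\<forall>x\<in>S. \<forall>y\<in>S. x + y \<in> S \<and> x * y \<in> S)"

lemma is_subringD:
  assumes "is_subring S"
  shows "1 \<in> S" "x \<in> S \<Longrightarrow> - x \<in> S" "x \<in> S \<Longrightarrow> y \<in> S \<Longrightarrow> x + y \<in> S"
    "x \<in> S \<Longrightarrow> y \<in> S \<Longrightarrow> x * y \<in> S" "0 \<in> S" "x \<in> S \<Longrightarrow> y \<in> S \<Longrightarrow> x - y \<in> S"
    "x \<in> S \<Longrightarrow> x ^ n \<in> S"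
proof -
  show *: "1 \<in> S" "x \<in> S \<Longrightarrow> - x \<in> S" "x \<in> S \<Longrightarrow> y \<in> S \<Longrightarrow> x + y \<in> S"
    "x \<in> S \<Longrightarrow> y \<in> S \<Longrightarrow> x * y \<in> S" for x y
    using assms by (auto simp: is_subring_def)
  show "0 \<in> S" using *(1) *(2)[of 1] *(3)[of 1 "-1"] by simp
  show "x \<in> S \<Longrightarrow> y \<in> S \<Longrightarrow> x - y \<in> S"
    using *(3)[of x "-y"] *(2)[of y] by simp
  show "x \<in> S \<Longrightarrow> x ^ n \<in> S" by (induction n) (auto intro: *)
qed

lemma is_subring_sum: "is_subring S \<Longrightarrow> (\<And>i. i \<in> I \<Longrightarrow> f i \<in> S) \<Longrightarrow> sum f I \<in> S"
  by (induction I rule: infinite_finite_induct) (auto intro: is_subringD)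

lemma is_subring_prod: "is_subring S \<Longrightarrow> (\<And>i. i \<in> I \<Longrightarrow> f i \<in> S) \<Longrightarrow> prod f I \<in> S"
  by (induction I rule: infinite_finite_induct) (auto intro: is_subringD)

lemma is_subring_ring_gen [simp]: "is_subring (ring_gen F)"
  by (auto simp: is_subring_def intro: ring_gen.intros)

lemma ring_gen_least:
  assumes "F \<subseteq> S" "is_subring S" shows "ring_gen F \<subseteq> S"
proof
  fix x assume "x \<in> ring_gen F" then show "x \<in> S"
    by induction (use assms in \<open>auto intro: is_subringD\<close>)
qed

lemma ring_gen_subset: "F \<subseteq> ring_gen F"
  by (auto intro: ring_gen.base)

lemma ring_gen_mono: "F \<subseteq> G \<Longrightarrow> ring_gen F \<subseteq> ring_gen G"
  by (rule ring_gen_least) (auto intro: ring_gen.base)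

definition coeffs_in :: "'a::comm_ring_1 set \<Rightarrow> 'a poly \<Rightarrow> bool" where
  "coeffs_in S Q \<longleftrightarrow> (\<forall>i. Polynomial.coeff Q i \<in> S)"

lemma coeffs_in_poly:
  assumes "is_subring S" "coeffs_in S Q" "x \<in> S" shows "poly Q x \<in> S"
  unfolding poly_altdef
  by (intro is_subring_sum is_subringD(4) is_subringD(7) assms)
     (use assms in \<open>auto simp: coeffs_in_def\<close>)

lemma coeffs_in_pCons [simp]:
  "coeffs_in S (pCons a Q) \<longleftrightarrow> a \<in> S \<and> coeffs_in S Q"
proof -
  have "coeffs_in S (pCons a Q) \<longleftrightarrow> (\<forall>i. Polynomial.coeff (pCons a Q) i \<in> S)"
    by (simp add: coeffs_in_def)
  also have "\<dots> \<longleftrightarrow> Polynomial.coeff (pCons a Q) 0 \<in> S \<and> (\<forall>i. Polynomial.coeff (pCons a Q) (Suc i) \<in> S)"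
    by (metis not0_implies_Suc)
  finally show ?thesis by (simp add: coeffs_in_def)
qed

lemma coeffs_in_0 [simp]: "is_subring S \<Longrightarrow> coeffs_in S 0"
  by (simp add: coeffs_in_def is_subringD)

lemma is_subring_coeffs_in: 
  assumes S: "is_subring S" shows "is_subring {Q. coeffs_in S Q}"
proof -
  have "Polynomial.coeff 1 i \<in> S" for i
    using is_subringD(1,5)[OF S] by (cases i) (auto simp: coeff_1)
  then show ?thesis
  unfolding is_subring_def
  by (auto simp: coeffs_in_def coeff_mult is_subringD(1,2,5)[OF S]
           intro!: is_subring_sum S is_subringD(3,4))
qed

lemmas coeffs_in_closed = is_subringD[OF is_subring_coeffs_in, unfolded mem_Collect_eq]

lemma coeffs_in_monom: "is_subring S \<Longrightarrow> a \<in> S \<Longrightarrow> coeffs_in S (Polynomial.monom a n)"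
  by (auto simp: coeffs_in_def is_subringD)

text \<open>
  Adjoining one generator after the other turns statements about finitely generated rings into
  statements about univariate polynomials.
\<close>

lemma ring_gen_insert:
  "ring_gen (insert x F) = {poly Q x |Q. coeffs_in (ring_gen F) Q}" (is "_ = ?R")
proof
  have sub: "is_subring ?R"
    unfolding is_subring_def
  proof (intro conjI ballI)
    show "1 \<in> ?R" by (rule CollectI, rule exI[of _ 1]) (simp add: coeffs_in_closed)
    fix a assume "a \<in> ?R"
    then obtain P where P: "a = poly P x" "coeffs_in (ring_gen F) P" by auto
    show "- a \<in> ?R" using P by (auto intro!: exI[of _ "-P"] coeffs_in_closed)
    fix b assume "b \<in> ?R"
    then obtain Q where Q: "b = poly Q x" "coeffs_in (ring_gen F) Q" by auto
    show "a + b \<in> ?R" using P Q by (auto intro!: exI[of _ "P+Q"] coeffs_in_closed)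
    show "a * b \<in> ?R" using P Q by (auto intro!: exI[of _ "P*Q"] coeffs_in_closed)
  qed
  have "insert x F \<subseteq> ?R"
  proof
    fix y assume "y \<in> insert x F"
    then consider "y = x" | "y \<in> F" by auto
    then show "y \<in> ?R"
    proof cases
      case 1
      then show ?thesis
        by (intro CollectI exI[of _ "[:0,1:]"]) (auto intro: is_subringD)
    next
      case 2
      then show ?thesis
        by (intro CollectI exI[of _ "[:y:]"]) (auto intro: is_subringD ring_gen.base)
    qed
  qed
  then show "ring_gen (insert x F) \<subseteq> ?R"
    using ring_gen_least sub by blast
next
  show "?R \<subseteq> ring_gen (insert x F)"
  proof clarify
    fix Q assume "coeffs_in (ring_gen F) Q"
    then have "coeffs_in (ring_gen (insert x F)) Q"
      unfolding coeffs_in_def using ring_gen_mono[of F "insert x F"] by blast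
    then show "poly Q x \<in> ring_gen (insert x F)"
      by (rule coeffs_in_poly[rotated]) (auto intro: ring_gen.base)
  qed
qed

text \<open>
  For a subring \<open>S\<close>, this is transcendence of \<open>x\<close> over \<open>S\<close>. Speaking of subrings instead of fields of
  fractions suffices because all rings that occur are domains.
\<close>

definition transcendental :: "'a::comm_ring_1 set \<Rightarrow> 'a \<Rightarrow> bool" where
  "transcendental S x \<longleftrightarrow> (\<forall>Q. coeffs_in S Q \<longrightarrow> poly Q x = 0 \<longrightarrow> Q = 0)"

lemma transcD: "transcendental S x \<Longrightarrow> coeffs_in S Q \<Longrightarrow> poly Q x = 0 \<Longrightarrow> Q = 0"
  by (auto simp: transcendental_def)

lemma transc_mono: "transcendental T x \<Longrightarrow> S \<subseteq> T \<Longrightarrow> transcendental S x"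
  unfolding transcendental_def coeffs_in_def by blast

lemma poly_as_sum:
  fixes x :: "'a::comm_ring_1"
  assumes "Polynomial.degree Q \<le> n"
  shows "poly Q x = (\<Sum>i\<le>n. Polynomial.coeff Q i * x ^ i)"
  unfolding poly_altdef using assms by (intro sum.mono_neutral_left) (auto simp: coeff_eq_0)

text \<open>
  A relation for \<open>x\<close> over the ring generated by \<open>F\<close> and \<open>y\<close> is a double sum \<open>\<Sum> s\<^sub>i\<^sub>j y\<^sup>j x\<^sup>i = 0\<close>. Read as a
  relation for \<open>y\<close> over the ring generated by \<open>F\<close> and \<open>x\<close>, it shows that the coefficient of each \<open>y\<^sup>j\<close>
  vanishes, and then so does each \<open>s\<^sub>i\<^sub>j\<close>, because \<open>x\<close> is transcendental over \<open>F\<close>.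
\<close>

lemma transc_exchange:
  assumes x: "transcendental (ring_gen F) x" and y: "transcendental (ring_gen (insert x F)) y"
  shows "transcendental (ring_gen (insert y F)) x"
  unfolding transcendental_def
proof (intro allI impI)
  fix Q assume Q: "coeffs_in (ring_gen (insert y F)) Q" and Q0: "poly Q x = 0"
  have "\<exists>P. coeffs_in (ring_gen F) P \<and> Polynomial.coeff Q i = poly P y" for i
  proof -
    have "Polynomial.coeff Q i \<in> ring_gen (insert y F)" using Q by (simp add: coeffs_in_def)
    then show ?thesis unfolding ring_gen_insert by blast
  qed
  then obtain P where P: "\<And>i. coeffs_in (ring_gen F) (P i)"
    "\<And>i. Polynomial.coeff Q i = poly (P i) y" by metis
  define n where "n = Polynomial.degree Q"
  define N where "N = Max ((\<lambda>i. Polynomial.degree (P i)) ` {..n})"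
  have N: "Polynomial.degree (P i) \<le> N" if "i \<le> n" for i
    unfolding N_def using that by (intro Max_ge) auto
  \<comment> \<open>\<open>R j\<close> collects the terms with \<open>y\<^sup>j\<close> as a polynomial in \<open>x\<close>, and \<open>T\<close> is the relation for \<open>y\<close>.\<close>
  define R where "R j = (\<Sum>i\<le>n. Polynomial.monom (Polynomial.coeff (P i) j) i)" for j
  have coR: "Polynomial.coeff (R j) i = (if i \<le> n then Polynomial.coeff (P i) j else 0)" for i j
    unfolding R_def by (simp add: coeff_sum if_distrib)
  have R: "coeffs_in (ring_gen F) (R j)" for j
    using P(1) by (auto simp: coeffs_in_def coR is_subringD)
  have Rx: "poly (R j) x = (\<Sum>i\<le>n. Polynomial.coeff (P i) j * x ^ i)" for j
    by (simp add: R_def poly_sum poly_monom)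
  define T where "T = (\<Sum>j\<le>N. Polynomial.monom (poly (R j) x) j)"
  have coT: "Polynomial.coeff T j = (if j \<le> N then poly (R j) x else 0)" for j
    unfolding T_def by (simp add: coeff_sum if_distrib)
  have "coeffs_in (ring_gen (insert x F)) T"
  proof -
    have "poly (R j) x \<in> ring_gen (insert x F)" for j
      unfolding ring_gen_insert using R by blast
    then show ?thesis by (simp add: coeffs_in_def coT is_subringD)
  qed
  moreover have "poly T y = 0"
  proof -
    have "poly T y = (\<Sum>j\<le>N. \<Sum>i\<le>n. Polynomial.coeff (P i) j * x ^ i * y ^ j)"
      by (simp add: T_def poly_sum poly_monom Rx sum_distrib_right)
    also have "\<dots> = (\<Sum>i\<le>n. \<Sum>j\<le>N. Polynomial.coeff (P i) j * x ^ i * y ^ j)"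
      by (rule sum.swap)
    also have "\<dots> = (\<Sum>i\<le>n. poly (P i) y * x ^ i)"
      by (intro sum.cong refl, subst poly_as_sum[OF N])
         (auto simp: sum_distrib_right sum_distrib_left ac_simps)
    also have "\<dots> = poly Q x"
      unfolding P(2)[symmetric] by (simp add: n_def poly_altdef)
    finally show ?thesis using Q0 by simp
  qed
  ultimately have "T = 0" using y transcD by blast
  have "R j = 0" if "j \<le> N" for j
    using coT[of j] \<open>T = 0\<close> that transcD[OF x R] by simp
  then have "Polynomial.coeff (P i) j = 0" if "i \<le> n" "j \<le> N" for i j
    using coR[of j i] that by simp
  then have Pij: "Polynomial.coeff (P i) j = 0" if "i \<le> n" "j \<le> N" for i j
    using that by blast
  have "P i = 0" if "i \<le> n" for i
  proof (rule poly_eqI)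
    show "Polynomial.coeff (P i) j = Polynomial.coeff 0 j" for j
    proof (cases "j \<le> N")
      case False
      then show ?thesis using N[OF that] by (simp add: coeff_eq_0)
    qed (use Pij that in simp)
  qed
  then have "Polynomial.coeff Q i = 0" if "i \<le> n" for i
    using P(2)[of i] that by simp
  then have "Polynomial.coeff Q n = 0" by simp
  then show "Q = 0" by (simp add: n_def)
qed

text \<open>
  The exchange lemma is applied to the entries of \<open>ys\<close> from the last to the first.
\<close>

lemma transc_adjoin:
  assumes "transcendental (ring_gen F) x"
    and "\<And>ys' y ys''. ys = ys' @ y # ys'' \<Longrightarrow> transcendental (ring_gen (insert x (F \<union> set ys''))) y"
  shows "transcendental (ring_gen (F \<union> set ys)) x"
  using assms(2)
proof (induction ys)
  case Nil
  then show ?case using assms(1) by simp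
next
  case (Cons y ys)
  have "transcendental (ring_gen (F \<union> set ys)) x"
    by (rule Cons.IH) (metis Cons.prems append_Cons)
  moreover have "transcendental (ring_gen (insert x (F \<union> set ys))) y"
    using Cons.prems[of "[]"] by simp
  ultimately have "transcendental (ring_gen (insert y (F \<union> set ys))) x"
    by (rule transc_exchange)
  then show ?case by simp
qed

text \<open>
  Algebraic independence over the ring generated by \<open>F\<close>, one element at a time: each entry is
  transcendental over the ring generated by \<open>F\<close> and the entries after it. In this form no polynomials
  in several indeterminates are needed to express independence.
\<close>

fun alg_indep :: "'a::comm_ring_1 set \<Rightarrow> 'a list \<Rightarrow> bool" where
  "alg_indep F [] \<longleftrightarrow> True"
| "alg_indep F (x # xs) \<longleftrightarrow> transcendental (ring_gen (F \<union> set xs)) x \<and> alg_indep F xs"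

text \<open>
  The elements of \<open>as\<close> are among the scalars over which \<open>xs\<close> is independent. This is how the independent
  elements found inside \<open>K[F]\<close> are combined with variables that are independent over \<open>K[F]\<close>. With empty
  \<open>as\<close> it says that independence passes to smaller rings of scalars.
\<close>

lemma indep_append_smaller:
  assumes "alg_indep F xs" "alg_indep C as" "C \<subseteq> ring_gen F" "set as \<subseteq> ring_gen F"
  shows "alg_indep C (xs @ as)"
  using assms(1)
proof (induction xs)
  case (Cons x xs)
  have "C \<union> set (xs @ as) \<subseteq> ring_gen (F \<union> set xs)"
    using assms(3,4) ring_gen_mono[of F "F \<union> set xs"] ring_gen_subset[of "F \<union> set xs"] by auto
  then have "ring_gen (C \<union> set (xs @ as)) \<subseteq> ring_gen (F \<union> set xs)"
    by (rule ring_gen_least) simp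
  then show ?case using Cons transc_mono by auto
qed (use assms in simp)

text \<open>
  Induction on the chain, removing its smallest prime. Let \<open>a\<close> lie in \<open>P 1\<close> but not in \<open>P 0\<close>, and let \<open>Q\<close>
  have coefficients in the ring generated by the elements found so far, with \<open>Q(a)\<close> in \<open>P 0\<close>. The constant
  coefficient of \<open>Q\<close> then lies in \<open>P 1\<close>, where the induction hypothesis makes it zero; as \<open>P 0\<close> is prime,
  the factor \<open>a\<close> can be cancelled from the remaining terms, and so on until \<open>Q = 0\<close>. The last conjunct of
  the conclusion is what drives the induction.
\<close>

lemma prime_chain_indep:
  fixes P :: "nat \<Rightarrow> 'a::comm_ring_1 set"
  assumes A: "is_subring A" "C \<subseteq> A"
    and P: "\<And>i. i \<le> n \<Longrightarrow> P i \<subseteq> A" "\<And>i. i \<le> n \<Longrightarrow> 0 \<in> P i"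
      "\<And>i x y. i \<le> n \<Longrightarrow> x \<in> P i \<Longrightarrow> y \<in> P i \<Longrightarrow> x - y \<in> P i"
      "\<And>i x y. i \<le> n \<Longrightarrow> x \<in> A \<Longrightarrow> y \<in> P i \<Longrightarrow> x * y \<in> P i"
      "\<And>i x y. i \<le> n \<Longrightarrow> x \<in> A \<Longrightarrow> y \<in> A \<Longrightarrow> x * y \<in> P i \<Longrightarrow> x \<in> P i \<or> y \<in> P i"
    and base: "ring_gen C \<inter> P n \<subseteq> {0}"
    and strict: "\<And>i. i < n \<Longrightarrow> P i \<subset> P (Suc i)"
  shows "\<exists>as. length as = n \<and> set as \<subseteq> A \<and> alg_indep C as \<and> ring_gen (C \<union> set as) \<inter> P 0 \<subseteq> {0}"
  using P base strict
proof (induction n arbitrary: P)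
  case 0
  then show ?case by auto
next
  case (Suc n)
  obtain as where as: "length as = n" "set as \<subseteq> A" "alg_indep C as"
    "ring_gen (C \<union> set as) \<inter> P (Suc 0) \<subseteq> {0}"
  proof -
    have "\<exists>as. length as = n \<and> set as \<subseteq> A \<and> alg_indep C as
        \<and> ring_gen (C \<union> set as) \<inter> P (Suc 0) \<subseteq> {0}"
    proof (rule Suc.IH[of "\<lambda>i. P (Suc i)"])
      fix i x y assume i: "i \<le> n"
      then have i': "Suc i \<le> Suc n" by simp
      show "P (Suc i) \<subseteq> A" "0 \<in> P (Suc i)" using Suc.prems(1,2)[OF i'] by auto
      show "x \<in> P (Suc i) \<Longrightarrow> y \<in> P (Suc i) \<Longrightarrow> x - y \<in> P (Suc i)"
        by (rule Suc.prems(3)[OF i'])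
      show "x \<in> A \<Longrightarrow> y \<in> P (Suc i) \<Longrightarrow> x * y \<in> P (Suc i)"
        by (rule Suc.prems(4)[OF i'])
      show "x \<in> A \<Longrightarrow> y \<in> A \<Longrightarrow> x * y \<in> P (Suc i) \<Longrightarrow> x \<in> P (Suc i) \<or> y \<in> P (Suc i)"
        by (rule Suc.prems(5)[OF i'])
    next
      show "ring_gen C \<inter> P (Suc n) \<subseteq> {0}" by (rule Suc.prems(6))
      show "P (Suc i) \<subset> P (Suc (Suc i))" if "i < n" for i
        using Suc.prems(7)[of "Suc i"] that by simp
    qed
    then show ?thesis using that by blast
  qed
  obtain a where a: "a \<in> P (Suc 0)" "a \<notin> P 0"
    using Suc.prems(7)[of 0] by auto
  have aA: "a \<in> A" using a Suc.prems(1)[of "Suc 0"] by auto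
  define S where "S = ring_gen (C \<union> set as)"
  have SA: "S \<subseteq> A" unfolding S_def by (rule ring_gen_least) (use A as in auto)
  have *: "Q = 0" if "coeffs_in S Q" "poly Q a \<in> P 0" for Q
    using that
  proof (induction Q)
    case (pCons q Q)
    have inA: "q \<in> A" "poly Q a \<in> A"
      using pCons.prems(1) SA aA A coeffs_in_poly[of A Q a]
      by (auto simp: coeffs_in_def[of _ Q])
    have "q + a * poly Q a \<in> P 0" using pCons.prems by simp
    then have 1: "q + a * poly Q a \<in> P (Suc 0)" using Suc.prems(7)[of 0] by auto
    have "a * poly Q a \<in> P (Suc 0)"
      using Suc.prems(4)[of "Suc 0" "poly Q a" a] a inA by (simp add: mult.commute)
    then have "q \<in> P (Suc 0)"
      using Suc.prems(3)[of "Suc 0" "q + a * poly Q a" "a * poly Q a"] 1 by simp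
    then have q: "q = 0" using as(4) pCons.prems by (auto simp: S_def)
    then have "a * poly Q a \<in> P 0" using pCons.prems by simp
    then have "poly Q a \<in> P 0" using Suc.prems(5)[of 0] a(2) aA inA by auto
    then have "Q = 0" using pCons by simp
    then show ?case using q by simp
  qed simp
  have "transcendental S a"
    unfolding transcendental_def using * Suc.prems(2)[of 0] by auto
  moreover have "ring_gen (insert a (C \<union> set as)) \<inter> P 0 \<subseteq> {0}"
  proof
    fix z assume "z \<in> ring_gen (insert a (C \<union> set as)) \<inter> P 0"
    then obtain Q where "coeffs_in S Q" "z = poly Q a" "z \<in> P 0"
      unfolding ring_gen_insert S_def[symmetric] by auto
    then have "Q = 0" using * by simp
    then show "z \<in> {0}" using \<open>z = poly Q a\<close> by simp
  qed
  ultimately show ?case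
    using as aA by (intro exI[of _ "a # as"]) (auto simp: S_def)
qed

text \<open>
  The map \<open>\<sigma>\<close> specialises \<open>x\<close> to \<open>c\<close>. Applied to a relation \<open>Q(x) = 0\<close> it gives \<open>\<sigma>(Q(c)) = 0\<close>, hence
  \<open>Q(c) = 0\<close> by injectivity. So \<open>Y - c\<close> divides \<open>Q\<close>, and as \<open>x - c\<close> is not zero, the quotient is a relation
  of smaller degree.
\<close>

lemma transc_if_specialization_inj:
  fixes x :: "'a::idom"
  assumes B: "is_subring B" "c \<in> B"
    and \<sigma>: "\<And>a b. \<sigma> (a + b) = \<sigma> a + \<sigma> b" "\<And>a b. \<sigma> (a * b) = \<sigma> a * \<sigma> b"
      "\<sigma> c = c" "\<sigma> x = c"
    and inj: "\<And>b. b \<in> B \<Longrightarrow> \<sigma> b = 0 \<Longrightarrow> b = 0" and "x \<noteq> c"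
  shows "transcendental B x"
  unfolding transcendental_def
proof (intro allI impI)
  have \<sigma>0: "\<sigma> 0 = 0" using \<sigma>(1)[of 0 0] add_left_cancel[of "\<sigma> 0" "\<sigma> 0" 0] by simp
  have eval: "\<sigma> (poly Q x) = \<sigma> (poly Q c)" for Q
    by (induction Q) (simp_all add: \<sigma>)
  fix Q assume "coeffs_in B Q" "poly Q x = 0"
  then show "Q = 0"
  proof (induction "Polynomial.degree Q" arbitrary: Q rule: less_induct)
    case less
    have "\<sigma> (poly Q c) = 0" using eval[of Q] less.prems \<sigma>0 by simp
    then have Qc: "poly Q c = 0"
      using inj coeffs_in_poly B less.prems by blast
    define R where "R = synthetic_div Q c"
    have QR: "Q = [:- c, 1:] * R"
      using synthetic_div_correct'[of c Q] Qc by (simp add: R_def)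
    have Rc: "coeffs_in B (synthetic_div P c)" if "coeffs_in B P" for P
      using that by (induction P) (auto simp: B intro: coeffs_in_poly)
    have "poly Q x = (x - c) * poly R x" by (simp add: QR algebra_simps)
    then have "poly R x = 0" using less.prems \<open>x \<noteq> c\<close> by simp
    show "Q = 0"
    proof (cases "Polynomial.degree Q = 0")
      case True
      then obtain q where "Q = [:q:]" by (rule degree_eq_zeroE)
      then show ?thesis using less.prems by simp
    next
      case False
      then have "Polynomial.degree R < Polynomial.degree Q"
        by (simp add: R_def degree_synthetic_div)
      then have "R = 0" using less.hyps Rc less.prems \<open>poly R x = 0\<close> R_def by blast
      then show ?thesis by (simp add: QR)
    qed
  qed
qed

section \<open>Polynomials in several variables\<close>

definition is_hom :: "('a::comm_ring_1 \<Rightarrow> 'b::comm_ring_1) \<Rightarrow> bool" where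
  "is_hom f \<longleftrightarrow> f 1 = 1 \<and> (\<forall>x y. f (x + y) = f x + f y) \<and> (\<forall>x y. f (x * y) = f x * f y)"

lemma is_homD:
  assumes "is_hom f"
  shows "f 1 = 1" "f (x + y) = f x + f y" "f (x * y) = f x * f y" "f 0 = 0" "f (- x) = - f x"
    "f (x - y) = f x - f y" "f (x ^ n) = f x ^ n"
proof -
  show *: "f 1 = 1" "\<And>x y. f (x + y) = f x + f y" "\<And>x y. f (x * y) = f x * f y"
    using assms by (auto simp: is_hom_def)
  show 0: "f 0 = 0" using *(2)[of 0 0] add_left_cancel[of "f 0" "f 0" 0] by simp
  show m: "f (- x) = - f x" for x using *(2)[of x "-x"] 0 by (simp add: eq_neg_iff_add_eq_0 add.commute)
  show "f (x - y) = f x - f y" using *(2)[of x "-y"] m[of y] by simp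
  show "f (x ^ n) = f x ^ n" by (induction n) (simp_all add: *)
qed

lemma is_hom_poly:
  assumes "is_hom f" shows "f (poly Q x) = poly (map_poly f Q) (f x)"
  by (induction Q) (simp_all add: is_homD[OF assms] map_poly_pCons)

lemma is_hom_comp: "is_hom f \<Longrightarrow> is_hom g \<Longrightarrow> is_hom (f \<circ> g)"
  by (simp add: is_hom_def)

lemma is_hom_agree:
  assumes "is_hom f" "is_hom g" "\<And>x. x \<in> F \<Longrightarrow> f x = g x" "x \<in> ring_gen F"
  shows "f x = g x"
  using assms(4) by induction (simp_all add: assms is_homD[OF assms(1)] is_homD[OF assms(2)])

lemma is_hom_image:
  assumes "is_hom f" shows "f ` ring_gen F = ring_gen (f ` F)"
proof
  show "f ` ring_gen F \<subseteq> ring_gen (f ` F)"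
  proof clarify
    fix x assume "x \<in> ring_gen F"
    then show "f x \<in> ring_gen (f ` F)"
      by induction (auto simp: is_homD[OF assms] intro: ring_gen.intros)
  qed
  show "ring_gen (f ` F) \<subseteq> f ` ring_gen F"
  proof
    fix y assume "y \<in> ring_gen (f ` F)"
    then show "y \<in> f ` ring_gen F"
    proof induction
      case one
      show ?case by (rule image_eqI[of _ _ 1]) (auto simp: is_homD[OF assms] intro: ring_gen.one)
    next
      case (uminus x)
      then obtain a where "a \<in> ring_gen F" "x = f a" by auto
      then show ?case
        by (intro image_eqI[of _ _ "- a"]) (simp_all add: is_homD[OF assms] ring_gen.uminus)
    next
      case (add x y)
      then obtain a b where "a \<in> ring_gen F" "b \<in> ring_gen F" "x = f a" "y = f b" by auto
      then show ?case
        by (intro image_eqI[of _ _ "a + b"]) (simp_all add: is_homD[OF assms] ring_gen.add)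
    next
      case (mult x y)
      then obtain a b where "a \<in> ring_gen F" "b \<in> ring_gen F" "x = f a" "y = f b" by auto
      then show ?case
        by (intro image_eqI[of _ _ "a * b"]) (simp_all add: is_homD[OF assms] ring_gen.mult)
    qed (auto intro: ring_gen.base)
  qed
qed

definition mconst :: "'k::field \<Rightarrow> ('x, 'k) mpoly" where
  "mconst c = Poly_Mapping.single 0 c"

lemma is_hom_mconst: "is_hom mconst"
  by (simp add: is_hom_def mconst_def single_add mult_single)

lemmas mconst_simps = is_homD[OF is_hom_mconst]

lemma inj_mconst: "inj mconst"
  unfolding mconst_def by (rule inj_single)

lemma mconst_eq_iff [simp]: "mconst a = mconst b \<longleftrightarrow> a = b"
  using inj_mconst by (auto simp: inj_def)

lemma mconst_eq_0_iff [simp]: "mconst a = 0 \<longleftrightarrow> a = 0"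
  using mconst_eq_iff[of a 0] by (simp add: mconst_simps del: mconst_eq_iff)

text \<open>
  The polynomials in the variables \<open>V\<close>, given by generators to allow induction over \<open>ring_gen\<close>; \<open>polys_eq\<close>
  is the description by monomials.
\<close>

definition polys :: "'x set \<Rightarrow> ('x, 'k::field) mpoly set" where
  "polys V = ring_gen (range mconst \<union> mpoly_var ` V)"

lemma is_subring_polys [simp]: "is_subring (polys V)"
  by (simp add: polys_def)

lemma mconst_in_polys [simp]: "mconst c \<in> polys V"
  by (auto simp: polys_def intro: ring_gen.base)

lemma mpoly_var_in_polys: "x \<in> V \<Longrightarrow> mpoly_var x \<in> polys V"
  by (auto simp: polys_def intro: ring_gen.base)

lemma polys_mono: "V \<subseteq> Y \<Longrightarrow> polys V \<subseteq> polys Y"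
  unfolding polys_def by (rule ring_gen_mono) auto

lemma poly_mapping_sum_single:
  "p = (\<Sum>m\<in>Poly_Mapping.keys p. Poly_Mapping.single m (Poly_Mapping.lookup p m))"
proof (rule poly_mapping_eqI)
  fix k
  have "Poly_Mapping.lookup (\<Sum>m\<in>Poly_Mapping.keys p. Poly_Mapping.single m (Poly_Mapping.lookup p m)) k =
     (\<Sum>m\<in>Poly_Mapping.keys p. if m = k then Poly_Mapping.lookup p m else 0)"
    by (simp add: lookup_sum lookup_single when_def)
  also have "\<dots> = Poly_Mapping.lookup p k"
    by (simp add: not_in_keys_iff_lookup_eq_zero)
  finally show "Poly_Mapping.lookup p k = Poly_Mapping.lookup (\<Sum>m\<in>Poly_Mapping.keys p. Poly_Mapping.single m (Poly_Mapping.lookup p m)) k"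
    by simp
qed

lemma single_sum_prod:
  "Poly_Mapping.single (sum f A) (1::'k::field) = (\<Prod>v\<in>A. Poly_Mapping.single (f v) 1)"
proof (induction A rule: infinite_finite_induct)
  case (insert x F)
  then show ?case using mult_single[of "f x" "1::'k" "sum f F" 1] by simp
qed simp_all

lemma mpoly_var_power:
  "mpoly_var x ^ n = Poly_Mapping.single (Poly_Mapping.single x n) (1::'k::field)"
  by (induction n) (simp_all add: mpoly_var_def mult_single single_add[symmetric])

lemma monomial_eq_prod:
  "Poly_Mapping.single m (c::'k::field) =
     mconst c * (\<Prod>v\<in>Poly_Mapping.keys m. mpoly_var v ^ Poly_Mapping.lookup m v)"
proof -
  have "Poly_Mapping.single m (1::'k) =
      (\<Prod>v\<in>Poly_Mapping.keys m. mpoly_var v ^ Poly_Mapping.lookup m v)"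
    unfolding mpoly_var_power single_sum_prod[symmetric] poly_mapping_sum_single[symmetric] ..
  moreover have "Poly_Mapping.single m c = mconst c * Poly_Mapping.single m 1"
    by (simp add: mconst_def mult_single)
  ultimately show ?thesis by simp
qed

lemma polys_eq: "polys V = {p. \<forall>m\<in>Poly_Mapping.keys p. Poly_Mapping.keys m \<subseteq> V}" (is "_ = ?R")
proof
  have "is_subring ?R"
    unfolding is_subring_def
  proof (intro conjI ballI)
    fix x y :: "('a, 'b) mpoly" assume x: "x \<in> ?R" and y: "y \<in> ?R"
    show "x + y \<in> ?R" using x y Poly_Mapping.keys_add[of x y] by auto
    show "x * y \<in> ?R"
    proof clarify
      fix m v assume m: "m \<in> Poly_Mapping.keys (x * y)" and v: "v \<in> Poly_Mapping.keys m"
      obtain a b where ab: "a \<in> Poly_Mapping.keys x" "b \<in> Poly_Mapping.keys y" "m = a + b"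
        using m Poly_Mapping.keys_mult[of x y] by auto
      then have "v \<in> Poly_Mapping.keys a \<union> Poly_Mapping.keys b"
        using v Poly_Mapping.keys_add[of a b] by auto
      then show "v \<in> V" using ab x y by auto
    qed
    show "- x \<in> ?R" using x by (auto simp: in_keys_iff)
  qed auto
  then show "polys V \<subseteq> ?R"
    unfolding polys_def by (rule ring_gen_least[rotated]) (auto simp: mconst_def mpoly_var_def split: if_splits)
next
  show "?R \<subseteq> polys V"
  proof
    fix p assume "p \<in> ?R"
    then show "p \<in> polys V"
      by (subst poly_mapping_sum_single)
         (auto simp: monomial_eq_prod subset_iff
            intro!: is_subring_sum is_subringD(4,7) is_subring_prod mpoly_var_in_polys)
  qed
qed

lemma in_polys_UNIV [simp]: "p \<in> polys UNIV"
  by (simp add: polys_eq)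

definition mpoly_eval :: "('k::field \<Rightarrow> 'b::comm_ring_1) \<Rightarrow> ('x \<Rightarrow> 'b) \<Rightarrow> ('x, 'k) mpoly \<Rightarrow> 'b" where
  "mpoly_eval \<kappa> \<theta> p = (\<Sum>m\<in>Poly_Mapping.keys p. \<kappa> (Poly_Mapping.lookup p m) *
      (\<Prod>v\<in>Poly_Mapping.keys m. \<theta> v ^ Poly_Mapping.lookup m v))"

context
  fixes \<kappa> :: "'k::field \<Rightarrow> 'b::comm_ring_1" and \<theta> :: "'x \<Rightarrow> 'b"
  assumes \<kappa>: "is_hom \<kappa>"
begin

private definition M :: "('x \<Rightarrow>\<^sub>0 nat) \<Rightarrow> 'b" where
  "M m = (\<Prod>v\<in>Poly_Mapping.keys m. \<theta> v ^ Poly_Mapping.lookup m v)"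

private lemma M_superset:
  assumes "finite A" "Poly_Mapping.keys m \<subseteq> A"
  shows "M m = (\<Prod>v\<in>A. \<theta> v ^ Poly_Mapping.lookup m v)"
  unfolding M_def using assms
  by (intro prod.mono_neutral_left) (auto simp: in_keys_iff)

private lemma M_add: "M (m + n) = M m * M n"
proof -
  let ?A = "Poly_Mapping.keys m \<union> Poly_Mapping.keys n"
  have "M (m + n) = (\<Prod>v\<in>?A. \<theta> v ^ Poly_Mapping.lookup (m + n) v)"
    by (rule M_superset) (auto simp: Poly_Mapping.keys_add)
  also have "\<dots> = M m * M n"
    by (simp add: M_superset[of ?A m] M_superset[of ?A n] lookup_add power_add prod.distrib)
  finally show ?thesis .
qed

private lemma eval_add: "mpoly_eval \<kappa> \<theta> (p + q) = mpoly_eval \<kappa> \<theta> p + mpoly_eval \<kappa> \<theta> q"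
  unfolding mpoly_eval_def
  by (rule setsum_keys_plus_distrib) (simp_all add: is_homD[OF \<kappa>] distrib_right)

private lemma eval_0: "mpoly_eval \<kappa> \<theta> 0 = 0"
  by (simp add: mpoly_eval_def)

private lemma eval_sum: "mpoly_eval \<kappa> \<theta> (sum f I) = (\<Sum>i\<in>I. mpoly_eval \<kappa> \<theta> (f i))"
  by (induction I rule: infinite_finite_induct) (simp_all add: eval_0 eval_add)

private lemma eval_single: "mpoly_eval \<kappa> \<theta> (Poly_Mapping.single m c) = \<kappa> c * M m"
  by (cases "c = 0") (simp_all add: eval_0 is_homD[OF \<kappa>], simp add: mpoly_eval_def M_def)

private lemma eval_mult: "mpoly_eval \<kappa> \<theta> (p * q) = mpoly_eval \<kappa> \<theta> p * mpoly_eval \<kappa> \<theta> q"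
proof -
  let ?s = "\<lambda>p m. Poly_Mapping.single m (Poly_Mapping.lookup p m)"
  have e: "mpoly_eval \<kappa> \<theta> r = (\<Sum>m\<in>Poly_Mapping.keys r. \<kappa> (Poly_Mapping.lookup r m) * M m)" for r
    by (simp add: mpoly_eval_def M_def)
  have "mpoly_eval \<kappa> \<theta> (p * q) = mpoly_eval \<kappa> \<theta>
      ((\<Sum>m\<in>Poly_Mapping.keys p. ?s p m) * (\<Sum>n\<in>Poly_Mapping.keys q. ?s q n))"
    by (simp flip: poly_mapping_sum_single)
  also have "\<dots> = (\<Sum>m\<in>Poly_Mapping.keys p. \<Sum>n\<in>Poly_Mapping.keys q.
      \<kappa> (Poly_Mapping.lookup p m) * M m * (\<kappa> (Poly_Mapping.lookup q n) * M n))"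
    by (simp add: sum_product eval_sum mult_single eval_single is_homD[OF \<kappa>] M_add ac_simps)
  also have "\<dots> = mpoly_eval \<kappa> \<theta> p * mpoly_eval \<kappa> \<theta> q"
    by (simp add: e sum_product)
  finally show ?thesis .
qed

lemma mpoly_eval_mconst [simp]: "mpoly_eval \<kappa> \<theta> (mconst c) = \<kappa> c"
  by (simp add: mconst_def eval_single M_def)

lemma mpoly_eval_var [simp]: "mpoly_eval \<kappa> \<theta> (mpoly_var v) = \<theta> v"
  by (simp add: mpoly_var_def eval_single M_def is_homD[OF \<kappa>])

lemma is_hom_mpoly_eval: "is_hom (mpoly_eval \<kappa> \<theta>)"
proof -
  have "mpoly_eval \<kappa> \<theta> 1 = 1"
    using mpoly_eval_mconst[of 1] by (simp add: mconst_simps is_homD[OF \<kappa>])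
  then show ?thesis by (simp add: is_hom_def eval_add eval_mult)
qed

end

definition mpoly_subst :: "('x \<Rightarrow> ('y, 'k::field) mpoly) \<Rightarrow> ('x, 'k) mpoly \<Rightarrow> ('y, 'k) mpoly" where
  "mpoly_subst = mpoly_eval mconst"

lemma mpoly_subst_mconst [simp]: "mpoly_subst \<theta> (mconst c) = mconst c"
  and mpoly_subst_var [simp]: "mpoly_subst \<theta> (mpoly_var v) = \<theta> v"
  and is_hom_mpoly_subst: "is_hom (mpoly_subst \<theta>)"
  by (simp_all add: mpoly_subst_def is_hom_mconst is_hom_mpoly_eval)

lemma mpoly_hom_agree:
  assumes "is_hom f" "is_hom g" "\<And>c. f (mconst c) = g (mconst c)"
    "\<And>v. v \<in> V \<Longrightarrow> f (mpoly_var v) = g (mpoly_var v)" "p \<in> polys V"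
  shows "f p = g p"
  by (rule is_hom_agree[OF assms(1,2) _ assms(5)[unfolded polys_def]]) (auto simp: assms(3,4))

lemma is_hom_id: "is_hom (\<lambda>x. x)"
  by (simp add: is_hom_def)

lemma mpoly_subst_id:
  assumes "\<And>v. v \<in> V \<Longrightarrow> \<theta> v = mpoly_var v" "p \<in> polys V"
  shows "mpoly_subst \<theta> p = p"
  using mpoly_hom_agree[OF is_hom_mpoly_subst is_hom_id _ _ assms(2), of \<theta>] assms(1) by simp

lemma polys_insert: "polys (insert x V) = {poly Q (mpoly_var x) |Q. coeffs_in (polys V) Q}"
  unfolding polys_def by (simp add: ring_gen_insert)

lemma infinite_consts:
  assumes "infinite (UNIV :: 'k::field set)"
  shows "infinite (range mconst :: ('x, 'k) mpoly set)"
  using assms finite_image_iff inj_mconst by blast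

text \<open>
  A substitution of a constant for \<open>x\<close> fixes polynomials without \<open>x\<close>. So every constant is a root of an
  equation that \<open>x\<close> satisfies over them, but there are infinitely many constants.
\<close>

lemma transc_mpoly_var:
  fixes x :: "'x::linorder"
  assumes inf: "infinite (UNIV :: 'k::field set)" and "x \<notin> V"
  shows "transcendental (polys V) (mpoly_var x :: ('x, 'k) mpoly)"
  unfolding transcendental_def
proof (intro allI impI)
  fix Q :: "('x, 'k) mpoly poly"
  assume Q: "coeffs_in (polys V) Q" and Q0: "poly Q (mpoly_var x) = 0"
  have "poly Q (mconst c) = 0" for c
  proof -
    define \<sigma> where "\<sigma> = mpoly_subst (mpoly_var(x := mconst c))"
    have \<sigma>: "is_hom \<sigma>" by (simp add: \<sigma>_def is_hom_mpoly_subst)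
    have "\<sigma> p = p" if "p \<in> polys V" for p
      unfolding \<sigma>_def by (rule mpoly_subst_id[OF _ that]) (use \<open>x \<notin> V\<close> in auto)
    then have "map_poly \<sigma> Q = Q"
      using Q by (intro poly_eqI) (simp add: coeff_map_poly is_homD[OF \<sigma>] coeffs_in_def)
    moreover have "\<sigma> (poly Q (mpoly_var x)) = 0" by (simp add: Q0 is_homD[OF \<sigma>])
    ultimately show ?thesis by (simp add: is_hom_poly[OF \<sigma>]) (simp add: \<sigma>_def)
  qed
  then have "range mconst \<subseteq> {r. poly Q r = 0}" by auto
  then have "infinite {r. poly Q r = 0}"
    using infinite_consts[OF inf] finite_subset by blast
  then show "Q = 0" using poly_roots_finite by blast
qed

text \<open>
  One variable at a time: regarded as a polynomial in \<open>x\<close> over the domain of polynomials in the other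
  variables, \<open>p\<close> has only finitely many roots, so some constant is not a root. The result is stated with
  a substitution instead of a value in \<open>K\<close>, so that it composes with other substitutions.
\<close>

lemma mpoly_nonvanishing_point:
  fixes p :: "('x::linorder, 'k::field) mpoly"
  assumes inf: "infinite (UNIV :: 'k::field set)" and "finite V" "p \<in> polys V" "p \<noteq> 0"
  shows "\<exists>c. mpoly_subst (\<lambda>v. mconst (c v)) p \<noteq> (0 :: ('x, 'k) mpoly)"
  using assms(2-)
proof (induction V arbitrary: p)
  case empty
  then have "mpoly_subst (\<lambda>v. mconst (c v)) p = p" for c
    using mpoly_subst_id[of "{}" "\<lambda>v. mconst (c v)" p] by simp
  then show ?case using empty by simp
next
  case (insert x V)
  obtain Q where Q: "p = poly Q (mpoly_var x)" "coeffs_in (polys V) Q"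
    using insert.prems(1) unfolding polys_insert by auto
  have "Q \<noteq> 0" using Q insert.prems by auto
  then have "finite {r. poly Q r = 0}" by (rule poly_roots_finite)
  then have "\<not> range mconst \<subseteq> {r. poly Q r = 0}"
    using infinite_consts[OF inf] finite_subset by blast
  then obtain a where a: "poly Q (mconst a) \<noteq> 0" by auto
  have "poly Q (mconst a) \<in> polys V" using Q by (intro coeffs_in_poly) auto
  then obtain c where c: "mpoly_subst (\<lambda>v. mconst (c v)) (poly Q (mconst a)) \<noteq> (0 :: ('x, 'k) mpoly)"
    using insert.IH a by blast
  define f :: "('x, 'k) mpoly \<Rightarrow> ('x, 'k) mpoly" where "f = mpoly_subst (\<lambda>v. mconst (c v))"
  define g :: "('x, 'k) mpoly \<Rightarrow> ('x, 'k) mpoly" where "g = mpoly_subst (\<lambda>v. mconst ((c(x := a)) v))"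
  have hom: "is_hom f" "is_hom g" by (simp_all add: f_def g_def is_hom_mpoly_subst)
  have "f q = g q" if "q \<in> polys V" for q
    by (rule mpoly_hom_agree[OF hom _ _ that]) (use insert.hyps in \<open>auto simp: f_def g_def\<close>)
  then have "map_poly f Q = map_poly g Q"
    using Q(2) by (intro poly_eqI) (simp add: coeff_map_poly is_homD[OF hom(1)] is_homD[OF hom(2)] coeffs_in_def)
  then have "g p = f (poly Q (mconst a))"
    by (simp add: Q(1) is_hom_poly hom) (simp add: f_def g_def)
  then have "g p \<noteq> 0" using c by (simp add: f_def)
  then show ?case unfolding g_def by blast
qed

interpretation mpv: vector_space "\<lambda>(c::'k::field) (p::('x, 'k) mpoly). mconst c * p"
  by unfold_locales (simp_all add: algebra_simps mconst_simps)

text \<open>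
  Bounding each exponent separately, rather than the total degree, makes the number of monomials
  a plain power of \<open>N + 1\<close>.
\<close>

definition box_monomials :: "'x set \<Rightarrow> nat \<Rightarrow> ('x, 'k::field) mpoly set" where
  "box_monomials V N = (\<lambda>m. Poly_Mapping.single m 1) `
     {m. Poly_Mapping.keys m \<subseteq> V \<and> (\<forall>v. Poly_Mapping.lookup m v \<le> N)}"

lemma card_box_monomials:
  assumes "finite V"
  shows "finite (box_monomials V N)" "card (box_monomials V N) \<le> (N + 1) ^ card V"
proof -
  let ?A = "{m :: 'a \<Rightarrow>\<^sub>0 nat. Poly_Mapping.keys m \<subseteq> V \<and> (\<forall>v. Poly_Mapping.lookup m v \<le> N)}"
  let ?r = "\<lambda>m. restrict (Poly_Mapping.lookup m) V"
  let ?B = "PiE V (\<lambda>_. {..N})"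
  have inj: "inj_on ?r ?A"
  proof (rule inj_onI, rule poly_mapping_eqI)
    fix m n v assume mn: "m \<in> ?A" "n \<in> ?A" "?r m = ?r n"
    show "Poly_Mapping.lookup m v = Poly_Mapping.lookup n v"
    proof (cases "v \<in> V")
      case True
      then show ?thesis using fun_cong[OF mn(3), of v] by simp
    next
      case False
      then show ?thesis using mn(1,2) by (metis (mono_tags, lifting) in_keys_iff mem_Collect_eq subsetD)
    qed
  qed
  have sub: "?r ` ?A \<subseteq> ?B" by auto
  have fB: "finite ?B" using assms by (intro finite_PiE) auto
  have fA: "finite ?A" using inj_on_finite[OF inj sub fB] .
  then show "finite (box_monomials V N)" by (simp add: box_monomials_def)
  have "card (box_monomials V N) \<le> card ?A"
    unfolding box_monomials_def by (rule card_image_le[OF fA])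
  also have "\<dots> \<le> card ?B" by (rule card_inj_on_le[OF inj sub fB])
  also have "\<dots> = (N + 1) ^ card V" using assms by (simp add: card_PiE)
  finally show "card (box_monomials V N) \<le> (N + 1) ^ card V" .
qed

lemma box_monomials_mono: "M \<le> N \<Longrightarrow> box_monomials V M \<subseteq> box_monomials V N"
  by (auto simp: box_monomials_def intro: order_trans)

lemma box_span_mult:
  assumes x: "x \<in> mpv.span (box_monomials V M)" and y: "y \<in> mpv.span (box_monomials V N)"
  shows "x * y \<in> mpv.span (box_monomials V (M + N))"
proof -
  have gen: "x * y \<in> mpv.span (box_monomials V (M + N))"
    if "x \<in> box_monomials V M" "y \<in> box_monomials V N" for x y
  proof (rule mpv.span_base)
    from that obtain m n where mn: "x = Poly_Mapping.single m 1" "y = Poly_Mapping.single n 1"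
      "Poly_Mapping.keys m \<subseteq> V" "Poly_Mapping.keys n \<subseteq> V"
      "\<forall>v. Poly_Mapping.lookup m v \<le> M" "\<forall>v. Poly_Mapping.lookup n v \<le> N"
      by (auto simp: box_monomials_def)
    have "Poly_Mapping.keys (m + n) \<subseteq> V" using mn Poly_Mapping.keys_add[of m n] by auto
    then show "x * y \<in> box_monomials V (M + N)"
      unfolding box_monomials_def mn mult_single
      using mn by (intro image_eqI[of _ _ "m + n"]) (auto simp: lookup_add intro: add_mono)
  qed
  have 1: "x * y \<in> mpv.span (box_monomials V (M + N))" if "x \<in> box_monomials V M" for x
    using y
  proof (induction rule: mpv.span_induct_alt)
    case base
    then show ?case by (simp add: mpv.span_zero)
  next
    case (step c a b)
    have "x * (mconst c * a + b) = mconst c * (x * a) + x * b" by (simp add: algebra_simps)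
    then show ?case using step gen[OF that] by (simp add: mpv.span_add mpv.span_scale)
  qed
  show ?thesis
    using x
  proof (induction rule: mpv.span_induct_alt)
    case base
    then show ?case by (simp add: mpv.span_zero)
  next
    case (step c a b)
    have "(mconst c * a + b) * y = mconst c * (a * y) + b * y" by (simp add: algebra_simps)
    then show ?case using step 1 by (simp add: mpv.span_add mpv.span_scale)
  qed
qed

lemma one_in_box_span: "1 \<in> mpv.span (box_monomials V N)"
proof (rule mpv.span_base)
  have "Poly_Mapping.single 0 1 \<in> box_monomials V N"
    unfolding box_monomials_def by (rule imageI) simp
  then show "1 \<in> box_monomials V N" by simp
qed

lemma box_span_power:
  assumes "x \<in> mpv.span (box_monomials V d)" shows "x ^ j \<in> mpv.span (box_monomials V (j * d))"
proof (induction j)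
  case (Suc j)
  then show ?case using box_span_mult[OF assms Suc] by simp
qed (simp add: one_in_box_span)

lemma polys_in_box_span:
  assumes "p \<in> polys V" shows "\<exists>N. p \<in> mpv.span (box_monomials V N)"
proof -
  let ?E = "(\<Union>m\<in>Poly_Mapping.keys p. Poly_Mapping.lookup m ` Poly_Mapping.keys m)"
  obtain N where N: "\<forall>n\<in>?E. n \<le> N"
    using finite_nat_set_iff_bounded_le[of ?E] by auto
  have "Poly_Mapping.lookup m v \<le> N" if "m \<in> Poly_Mapping.keys p" for m v
    using N that by (cases "v \<in> Poly_Mapping.keys m") (auto simp: in_keys_iff)
  then have "Poly_Mapping.single m 1 \<in> box_monomials V N" if "m \<in> Poly_Mapping.keys p" for m
    unfolding box_monomials_def using that assms by (intro imageI) (auto simp: polys_eq)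
  then have "(\<Sum>m\<in>Poly_Mapping.keys p. mconst (Poly_Mapping.lookup p m) * Poly_Mapping.single m 1)
     \<in> mpv.span (box_monomials V N)"
    by (intro mpv.span_sum mpv.span_scale mpv.span_base)
  also have "(\<Sum>m\<in>Poly_Mapping.keys p. mconst (Poly_Mapping.lookup p m) * Poly_Mapping.single m 1) = p"
    by (simp add: mconst_def mult_single flip: poly_mapping_sum_single)
  finally show ?thesis by blast
qed

fun power_products :: "nat \<Rightarrow> 'a::comm_ring_1 list \<Rightarrow> 'a set" where
  "power_products N [] = {1}"
| "power_products N (a # as) = (\<lambda>(j, w). a ^ j * w) ` ({..N} \<times> power_products N as)"

lemma power_products_in_box_span:
  assumes "\<And>a. a \<in> set as \<Longrightarrow> a \<in> mpv.span (box_monomials V d)"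
  shows "power_products N as \<subseteq> mpv.span (box_monomials V (length as * (N * d)))"
  using assms
proof (induction as)
  case (Cons a as)
  show ?case
  proof
    fix z assume "z \<in> power_products N (a # as)"
    then obtain j w where z: "z = a ^ j * w" "j \<le> N" "w \<in> power_products N as" by auto
    have "a ^ j \<in> mpv.span (box_monomials V (j * d))"
      using Cons.prems by (intro box_span_power) simp
    also have "mpv.span (box_monomials V (j * d)) \<subseteq> mpv.span (box_monomials V (N * d))"
      using z(2) by (intro mpv.span_mono box_monomials_mono) simp
    finally have "a ^ j * w \<in> mpv.span (box_monomials V (N * d + length as * (N * d)))"
      using Cons z(3) by (intro box_span_mult) auto
    then show "z \<in> mpv.span (box_monomials V (length (a # as) * (N * d)))" using z by simp
  qed
qed (simp add: one_in_box_span)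

text \<open>
  Collect a linear relation between the power products of \<open>a # as\<close> by powers of \<open>a\<close>. This is an algebraic
  relation for \<open>a\<close> over the ring generated by \<open>as\<close>, so each coefficient vanishes; the coefficients are
  linear relations between the power products of \<open>as\<close>.
\<close>

lemma power_products_independent:
  assumes "alg_indep (range mconst) (as :: ('x::linorder, 'k::field) mpoly list)"
  shows "finite (power_products N as) \<and> card (power_products N as) = (N + 1) ^ length as
    \<and> power_products N as \<subseteq> ring_gen (range mconst \<union> set as) \<and> mpv.independent (power_products N as)"
  using assms
proof (induction as)
  case Nil
  have "mpv.independent {1 :: ('x, 'k) mpoly}" using mpv.dependent_single[of 1] by simp
  then show ?case by (simp add: ring_gen.one)
next
  case (Cons a as)
  define W where "W = power_products N as"
  define S where "S = ring_gen (range mconst \<union> set as)"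
  define h where "h = (\<lambda>(j, w). a ^ j * w)"
  have W: "finite W" "card W = (N + 1) ^ length as" "W \<subseteq> S" "mpv.independent W"
    using Cons by (auto simp: W_def S_def)
  have a: "transcendental S a" using Cons.prems by (simp add: S_def)
  have zero: "0 \<notin> W" using W(4) mpv.dependent_zero by blast
  have key: "f (j, w) = 0"
    if f: "(\<Sum>(j, w)\<in>{..N} \<times> W. mconst (f (j, w)) * (a ^ j * w)) = 0" and jw: "j \<le> N" "w \<in> W"
    for f :: "nat \<times> ('x, 'k) mpoly \<Rightarrow> 'k" and j w
  proof -
    define Q where "Q = (\<Sum>j\<le>N. Polynomial.monom (\<Sum>w\<in>W. mconst (f (j, w)) * w) j)"
    have "mconst c \<in> S" for c by (auto simp: S_def intro: ring_gen.base)
    then have "coeffs_in S Q"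
      unfolding Q_def using W(3)
      by (intro is_subring_sum[OF is_subring_coeffs_in, simplified] coeffs_in_monom
          is_subring_sum is_subringD(4)) (auto simp: S_def)
    moreover have "poly Q a = 0"
      using f by (simp add: Q_def poly_sum poly_monom sum.cartesian_product[symmetric]
          sum_distrib_right sum_distrib_left ac_simps)
    ultimately have "Q = 0" using a transcD by blast
    then have "Polynomial.coeff Q j = 0" by simp
    moreover have "Polynomial.coeff Q j = (\<Sum>w\<in>W. mconst (f (j, w)) * w)"
      using jw by (simp add: Q_def coeff_sum if_distrib)
    ultimately show "f (j, w) = 0"
      using mpv.independentD[OF W(4) W(1), of "\<lambda>w. f (j, w)" w] jw by simp
  qed
  have inj: "inj_on h ({..N} \<times> W)"
  proof (rule inj_onI, rule ccontr)
    fix x x' assume x: "x \<in> {..N} \<times> W" "x' \<in> {..N} \<times> W" "h x = h x'" "x \<noteq> x'"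
    obtain j w j' w' where [simp]: "x = (j, w)" "x' = (j', w')" by (cases x, cases x')
    have *: "h (j, w) = h (j', w')" "j \<in> {..N}" "j' \<in> {..N}" "w \<in> W" "w' \<in> W"
      and ne: "\<not> (j = j' \<and> w = w')" using x by auto
    define f :: "nat \<times> ('x, 'k) mpoly \<Rightarrow> 'k" where
      "f x = (if x = (j, w) then 1 else 0) - (if x = (j', w') then 1 else 0)" for x
    have "(\<Sum>x\<in>{..N} \<times> W. mconst (f x) * h x) = (\<Sum>x\<in>{..N} \<times> W.
        (if x = (j, w) then h x else 0) - (if x = (j', w') then h x else 0))"
      by (intro sum.cong refl) (auto simp: f_def mconst_simps)
    also have "\<dots> = 0" using * W(1) by (simp add: sum_subtractf)
    finally have "(\<Sum>(j, w)\<in>{..N} \<times> W. mconst (f (j, w)) * (a ^ j * w)) = 0"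
      by (simp add: h_def case_prod_unfold)
    then have "f (j, w) = 0" by (rule key) (use * in auto)
    moreover have "f (j, w) = 1" using ne by (auto simp: f_def)
    ultimately show False by simp
  qed
  have pp: "power_products N (a # as) = h ` ({..N} \<times> W)" by (simp add: h_def W_def)
  have ind: "mpv.independent (h ` ({..N} \<times> W))"
    unfolding mpv.independent_explicit_finite_subsets
  proof (intro allI impI ballI)
    fix T u v assume T: "T \<subseteq> h ` ({..N} \<times> W)" "finite T"
      and s: "(\<Sum>v\<in>T. mconst (u v) * v) = 0" and v: "v \<in> T"
    define f where "f x = (if h x \<in> T then u (h x) else 0)" for x
    have "(\<Sum>x\<in>{..N} \<times> W. mconst (f x) * h x) = (\<Sum>y\<in>h ` ({..N} \<times> W). mconst (if y \<in> T then u y else 0) * y)"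
      by (simp add: sum.reindex[OF inj] f_def)
    also have "\<dots> = (\<Sum>v\<in>T. mconst (u v) * v)"
      using T W(1) by (intro sum.mono_neutral_cong_right) (auto simp: mconst_simps)
    finally have 0: "(\<Sum>(j, w)\<in>{..N} \<times> W. mconst (f (j, w)) * (a ^ j * w)) = 0"
      using s by (simp add: h_def case_prod_unfold)
    obtain j w where jw: "j \<le> N" "w \<in> W" "v = h (j, w)" using T v by auto
    show "u v = 0" using key[OF 0 jw(1,2)] jw v by (simp add: f_def)
  qed
  have "a ^ j * w \<in> ring_gen (range mconst \<union> set (a # as))" if "w \<in> W" for j w
  proof -
    have "S \<subseteq> ring_gen (range mconst \<union> set (a # as))"
      unfolding S_def by (rule ring_gen_mono) auto
    then show ?thesis using that W(3)
      by (intro is_subringD(4,7)) (auto intro: ring_gen.base)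
  qed
  then have "h ` ({..N} \<times> W) \<subseteq> ring_gen (range mconst \<union> set (a # as))" by (auto simp: h_def)
  then show ?case unfolding pp using ind W by (simp add: card_image[OF inj] card_cartesian_product)
qed

text \<open>
  If \<open>m\<close> independent elements lived in \<open>n < m\<close> variables, then their \<open>(N + 1)\<^sup>m\<close> power products with
  exponents at most \<open>N\<close> would be linearly independent elements of a space of dimension at most
  \<open>(c (N + 1))\<^sup>n\<close>, where \<open>c\<close> does not depend on \<open>N\<close>. This is impossible for \<open>N = c\<^sup>n\<close>.
\<close>

lemma indep_length_le:
  fixes as :: "('x::linorder, 'k::field) mpoly list"
  assumes "alg_indep (range mconst) as" "finite V" "set as \<subseteq> polys V"
  shows "length as \<le> card V"
proof (rule ccontr)
  define m n where "m = length as" and "n = card V"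
  assume "\<not> ?thesis"
  then have mn: "n + 1 \<le> m" by (simp add: m_def n_def)
  have "\<exists>D. \<forall>a\<in>set as. a \<in> mpv.span (box_monomials V (D a))"
    using polys_in_box_span assms(3) by (intro bchoice) blast
  then obtain D where D: "\<And>a. a \<in> set as \<Longrightarrow> a \<in> mpv.span (box_monomials V (D a))" by blast
  define d where "d = Max (D ` set as)"
  have d: "a \<in> mpv.span (box_monomials V d)" if "a \<in> set as" for a
  proof -
    have "D a \<le> d" using that by (simp add: d_def)
    then show ?thesis using D[OF that] mpv.span_mono[OF box_monomials_mono] by blast
  qed
  define c where "c = m * d + 1"
  have "N + 1 \<le> c ^ n" for N
  proof -
    have "(N + 1) ^ (n + 1) \<le> (N + 1) ^ m" using mn by (intro power_increasing) auto
    also have "\<dots> = card (power_products N as)"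
      using power_products_independent[OF assms(1), of N] by (simp add: m_def)
    also have "\<dots> \<le> card (box_monomials V (m * (N * d)) :: ('x, 'k) mpoly set)"
    proof -
      have "power_products N as \<subseteq> mpv.span (box_monomials V (m * (N * d)))"
        unfolding m_def using d by (rule power_products_in_box_span)
      from mpv.independent_span_bound[OF card_box_monomials(1)[OF assms(2)] _ this]
      show ?thesis using power_products_independent[OF assms(1), of N] by simp
    qed
    also have "\<dots> \<le> (m * (N * d) + 1) ^ n"
      unfolding n_def by (rule card_box_monomials(2)[OF assms(2)])
    also have "\<dots> \<le> (c * (N + 1)) ^ n"
      by (intro power_mono) (simp_all add: c_def algebra_simps)
    finally have "(N + 1) ^ (n + 1) \<le> (c * (N + 1)) ^ n" .
    then have "(N + 1) * (N + 1) ^ n \<le> c ^ n * (N + 1) ^ n"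
      by (simp only: power_mult_distrib power_add power_one_right mult.commute)
    then show ?thesis by (simp only: mult_le_cancel2) simp
  qed
  from this[of "c ^ n"] show False by simp
qed

section \<open>Krull dimension of algebras generated by polynomials\<close>

definition ring_of :: "'a::comm_ring_1 set \<Rightarrow> 'a ring" where
  "ring_of S = \<lparr>carrier = S, monoid.mult = (*), one = 1, ring.zero = 0, add = (+)\<rparr>"

lemma ring_of_simps [simp]:
  "carrier (ring_of S) = S" "x \<otimes>\<^bsub>ring_of S\<^esub> y = x * y" "\<one>\<^bsub>ring_of S\<^esub> = 1"
  "\<zero>\<^bsub>ring_of S\<^esub> = 0" "x \<oplus>\<^bsub>ring_of S\<^esub> y = x + y"
  by (simp_all add: ring_of_def)

lemma mpoly_ring_eq: "mpoly_ring V = ring_of (polys V)"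
  by (simp add: mpoly_ring_def ring_of_def polys_eq)

lemma cring_ring_of:
  assumes "is_subring S" shows "cring (ring_of S)"
proof (rule cringI)
  show "abelian_group (ring_of S)"
  proof (rule abelian_groupI)
    fix x assume "x \<in> carrier (ring_of S)"
    then show "\<exists>y\<in>carrier (ring_of S). y \<oplus>\<^bsub>ring_of S\<^esub> x = \<zero>\<^bsub>ring_of S\<^esub>"
      using is_subringD(2)[OF assms] by (intro bexI[of _ "- x"]) auto
  qed (auto simp: is_subringD[OF assms] ac_simps)
  show "comm_monoid (ring_of S)"
    by (rule comm_monoidI) (auto simp: is_subringD[OF assms] ac_simps)
qed (auto simp: algebra_simps)

lemma a_inv_ring_of:
  assumes "is_subring S" "x \<in> S" shows "\<ominus>\<^bsub>ring_of S\<^esub> x = - x"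
proof -
  interpret cring "ring_of S" by (rule cring_ring_of[OF assms(1)])
  show ?thesis by (rule minus_equality) (use assms in \<open>auto simp: is_subringD\<close>)
qed

definition is_prime_in :: "'a::comm_ring_1 set \<Rightarrow> 'a set \<Rightarrow> bool" where
  "is_prime_in S P \<longleftrightarrow> P \<subseteq> S \<and> 0 \<in> P \<and> 1 \<notin> P \<and> (\<forall>x\<in>P. \<forall>y\<in>P. x - y \<in> P)
     \<and> (\<forall>x\<in>S. \<forall>y\<in>P. x * y \<in> P) \<and> (\<forall>x\<in>S. \<forall>y\<in>S. x * y \<in> P \<longrightarrow> x \<in> P \<or> y \<in> P)"

lemma primeideal_ring_of:
  assumes S: "is_subring S" shows "primeideal P (ring_of S) \<longleftrightarrow> is_prime_in S P"
proof
  interpret cring "ring_of S" by (rule cring_ring_of[OF S])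
  assume "primeideal P (ring_of S)"
  then interpret P: primeideal P "ring_of S" .
  have sub: "P \<subseteq> S" using P.a_subset by simp
  have "x - y \<in> P" if "x \<in> P" "y \<in> P" for x y
  proof -
    have "\<ominus>\<^bsub>ring_of S\<^esub> y = - y" by (rule a_inv_ring_of[OF S subsetD[OF sub that(2)]])
    then show ?thesis using P.a_closed[OF that(1) P.a_inv_closed[OF that(2)]] by simp
  qed
  moreover have "1 \<notin> P"
  proof
    assume "1 \<in> P"
    then have "P = carrier (ring_of S)" by (intro P.one_imp_carrier) simp
    then show False using P.I_notcarr by simp
  qed
  moreover have "0 \<in> P" using P.zero_closed by simp
  moreover have "x * y \<in> P" if "x \<in> S" "y \<in> P" for x y
    using P.I_l_closed[OF that(2), of x] that by simp
  moreover have "x \<in> P \<or> y \<in> P" if "x \<in> S" "y \<in> S" "x * y \<in> P" for x y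
    using P.I_prime[of x y] that by simp
  ultimately show "is_prime_in S P" using sub unfolding is_prime_in_def by simp
next
  assume P: "is_prime_in S P"
  interpret cring "ring_of S" by (rule cring_ring_of[OF S])
  have diff: "x - y \<in> P" if "x \<in> P" "y \<in> P" for x y using P that by (simp add: is_prime_in_def)
  have zero: "0 \<in> P" and sub: "P \<subseteq> S" using P by (simp_all add: is_prime_in_def)
  have neg: "- x \<in> P" if "x \<in> P" for x using diff[OF zero that] by simp
  have add: "x + y \<in> P" if "x \<in> P" "y \<in> P" for x y using diff[OF that(1) neg[OF that(2)]] by simp
  have sg: "subgroup P (add_monoid (ring_of S))"
  proof (rule group.subgroupI)
    show "Group.group (add_monoid (ring_of S))" by (rule a_group)
    fix a assume "a \<in> P"
    then show "inv\<^bsub>add_monoid (ring_of S)\<^esub> a \<in> P"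
      using a_inv_ring_of[OF S, of a] sub neg by (auto simp: a_inv_def)
  qed (use zero sub add in auto)
  show "primeideal P (ring_of S)"
  proof (rule primeidealI)
    show "ideal P (ring_of S)"
    proof (rule idealI[OF ring_axioms sg])
      fix a x assume "a \<in> P" "x \<in> carrier (ring_of S)"
      then have "x * a \<in> P" using P by (simp add: is_prime_in_def)
      then show "x \<otimes>\<^bsub>ring_of S\<^esub> a \<in> P" "a \<otimes>\<^bsub>ring_of S\<^esub> x \<in> P" by (simp_all add: mult.commute)
    qed
    show "carrier (ring_of S) \<noteq> P" using P is_subringD(1)[OF S] by (auto simp: is_prime_in_def)
    show "a \<in> P \<or> b \<in> P" if "a \<in> carrier (ring_of S)" "b \<in> carrier (ring_of S)"
      "a \<otimes>\<^bsub>ring_of S\<^esub> b \<in> P" for a b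
      using P that by (simp add: is_prime_in_def)
  qed (rule cring_axioms)
qed

definition subalg :: "('x, 'k::field) mpoly set \<Rightarrow> ('x, 'k) mpoly set" where
  "subalg F = ring_gen (range mconst \<union> F)"

lemma is_subring_subalg [simp]: "is_subring (subalg F)"
  by (simp add: subalg_def)

lemma subalg_subset_polys: "F \<subseteq> polys V \<Longrightarrow> subalg F \<subseteq> polys V"
  unfolding subalg_def by (rule ring_gen_least) auto

lemma polys_subalg: "polys V = subalg (mpoly_var ` V)"
  by (simp add: polys_def subalg_def)

lemma subalg_mono: "F \<subseteq> G \<Longrightarrow> subalg F \<subseteq> subalg G"
  unfolding subalg_def by (rule ring_gen_mono) auto

lemma subalg_base: "x \<in> F \<Longrightarrow> x \<in> subalg F"
  by (auto simp: subalg_def intro: ring_gen.base)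

lemma mconst_in_subalg: "mconst c \<in> subalg F"
  by (auto simp: subalg_def intro: ring_gen.base)

text \<open>
  A maximal list of variables from \<open>V\<close> that is algebraically independent over \<open>K[F]\<close>: a transcendence
  basis, made of variables, of the rational functions in \<open>V\<close> over the field of fractions of \<open>K[F]\<close>.
\<close>

definition var_basis :: "'x set \<Rightarrow> ('x, 'k::field) mpoly set \<Rightarrow> 'x list \<Rightarrow> bool" where
  "var_basis V F vs \<longleftrightarrow> distinct vs \<and> set vs \<subseteq> V \<and> alg_indep (range mconst \<union> F) (map mpoly_var vs)
     \<and> (\<forall>x\<in>V - set vs. \<not> transcendental (subalg (F \<union> mpoly_var ` set vs)) (mpoly_var x))"

lemma var_basis_exists:
  assumes "finite V" shows "\<exists>vs. var_basis V F vs"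
proof -
  define good where "good vs \<longleftrightarrow> distinct vs \<and> set vs \<subseteq> V
    \<and> alg_indep (range mconst \<union> F) (map mpoly_var vs)" for vs
  have "good []" by (simp add: good_def)
  moreover have "length vs < Suc (card V)" if "good vs" for vs
    using that distinct_card[of vs] card_mono[OF assms, of "set vs"] by (simp add: good_def)
  ultimately obtain vs where vs: "good vs" "\<And>ws. good ws \<Longrightarrow> length ws \<le> length vs"
    using ex_has_greatest_nat[of good "[]" length "Suc (card V)"] by auto
  have "\<not> transcendental (subalg (F \<union> mpoly_var ` set vs)) (mpoly_var x)" if "x \<in> V - set vs" for x
  proof
    assume "transcendental (subalg (F \<union> mpoly_var ` set vs)) (mpoly_var x)"
    then have "good (x # vs)" using vs(1) that by (simp add: good_def subalg_def Un_assoc)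
    then show False using vs(2) by fastforce
  qed
  then show ?thesis using vs(1) by (auto simp: var_basis_def good_def)
qed

lemma ring_gen_consts: "ring_gen (range mconst) = range mconst"
proof
  have "is_subring (range mconst)"
    unfolding is_subring_def
    by (auto simp: mconst_simps(2,3,5)[symmetric]) (metis mconst_simps(1) rangeI)
  then show "ring_gen (range mconst) \<subseteq> range mconst" by (rule ring_gen_least[OF subset_refl])
qed (rule ring_gen_subset)

text \<open>
  Primes of \<open>K[F]\<close> contain no constants except zero, so the elements that witness the strict inclusions
  are independent over \<open>K\<close>, and they remain so together with \<open>vs\<close>.
\<close>

lemma prime_chain_le:
  fixes F :: "('x::linorder, 'k::field) mpoly set"
  assumes V: "finite V" "F \<subseteq> polys V" and vs: "var_basis V F vs"
    and P: "\<And>i. i \<le> n \<Longrightarrow> is_prime_in (subalg F) (P i)" "\<And>i. i < n \<Longrightarrow> P i \<subset> P (Suc i)"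
  shows "n \<le> card V - length vs"
proof -
  have "ring_gen (range mconst) \<inter> P n \<subseteq> {0}"
  proof
    fix z assume z: "z \<in> ring_gen (range mconst) \<inter> P n"
    then obtain c where c: "z = mconst c" by (auto simp: ring_gen_consts)
    have "c = 0"
    proof (rule ccontr)
      assume "c \<noteq> 0"
      then have "mconst (inverse c) * z = (1 :: ('x, 'k) mpoly)"
        by (simp add: c mconst_simps(1,3)[symmetric] del: mconst_eq_iff)
      moreover have "mconst (inverse c) * z \<in> P n"
        using P(1)[of n] z mconst_in_subalg[of "inverse c" F] by (auto simp: is_prime_in_def)
      ultimately show False using P(1)[of n] by (simp add: is_prime_in_def)
    qed
    then show "z \<in> {0}" by (simp add: c)
  qed
  then obtain as where as: "length as = n" "set as \<subseteq> subalg F" "alg_indep (range mconst) as"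
    using prime_chain_indep[of "subalg F" "range mconst" n P] P
    by (auto simp: is_prime_in_def mconst_in_subalg image_subset_iff)
  have "alg_indep (range mconst) (map mpoly_var vs @ as)"
    using vs as(2) by (intro indep_append_smaller[OF _ as(3)])
      (auto simp: var_basis_def subalg_def intro: ring_gen.base)
  moreover have "set (map mpoly_var vs @ as) \<subseteq> polys V"
    using vs as(2) subalg_subset_polys[OF V(2)] by (auto simp: var_basis_def intro: mpoly_var_in_polys)
  ultimately have "length (map mpoly_var vs @ as) \<le> card V"
    using indep_length_le V(1) by blast
  then show ?thesis using as(1) by simp
qed

lemma mpoly_var_neq_mconst: "mpoly_var x \<noteq> mconst c"
proof
  assume "mpoly_var x = (mconst c :: ('a, 'b) mpoly)"
  then have "Poly_Mapping.keys (mpoly_var x :: ('a, 'b) mpoly) = Poly_Mapping.keys (mconst c :: ('a, 'b) mpoly)" by simp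
  then have "Poly_Mapping.single x (1::nat) = 0"
    by (auto simp: mpoly_var_def mconst_def split: if_splits)
  then show False by (metis lookup_single_eq lookup_zero one_neq_zero)
qed

text \<open>
  Let \<open>ws\<close> be the variables outside \<open>vs\<close>, and \<open>P k\<close> the kernel on \<open>K[F]\<close> of the substitution that keeps
  the first \<open>k\<close> entries of \<open>ws\<close> and sends all other variables to the coordinates of a suitable point \<open>c\<close>. The
  next entry \<open>x\<close> of \<open>ws\<close> satisfies an equation over \<open>K[F][vs]\<close> whose leading coefficient does not vanish
  at \<open>c\<close>, so the equation survives all these substitutions. If \<open>P (k + 1)\<close> and \<open>P k\<close> were equal, the
  substitution for \<open>x\<close> would be injective on the image of \<open>K[F]\<close>, and \<open>x\<close> transcendental over it.
\<close>

lemma prime_chain_exists: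
  fixes F :: "('x::linorder, 'k::field) mpoly set"
  assumes inf: "infinite (UNIV :: 'k set)"
    and V: "finite V" "F \<subseteq> polys V" and vs: "var_basis V F vs"
  shows "\<exists>P. (\<forall>i\<le>card V - length vs. is_prime_in (subalg F) (P i))
     \<and> (\<forall>i<card V - length vs. P i \<subset> P (Suc i))"
proof -
  obtain ws where ws: "distinct ws" "set ws = V - set vs"
    using finite_distinct_list V(1) by (metis finite_Diff)
  define s where "s = length ws"
  have s: "s = card V - length vs"
    unfolding s_def using distinct_card[OF ws(1)] ws(2) vs V(1)
    by (simp add: var_basis_def card_Diff_subset distinct_card)
  define S where "S = subalg (F \<union> mpoly_var ` set vs)"
  have SV: "S \<subseteq> polys V"
    unfolding S_def using V(2) vs by (intro subalg_subset_polys) (auto simp: var_basis_def intro: mpoly_var_in_polys)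
  have "\<exists>Q. coeffs_in S Q \<and> poly Q (mpoly_var x) = 0 \<and> Q \<noteq> 0" if "x \<in> set ws" for x
    using vs that ws(2) by (auto simp: var_basis_def transcendental_def S_def)
  then obtain Q where Q: "\<And>x. x \<in> set ws \<Longrightarrow> coeffs_in S (Q x)"
      "\<And>x. x \<in> set ws \<Longrightarrow> poly (Q x) (mpoly_var x) = 0" "\<And>x. x \<in> set ws \<Longrightarrow> Q x \<noteq> 0"
    by metis
  define q where "q x = Polynomial.coeff (Q x) (Polynomial.degree (Q x))" for x
  have q: "q x \<noteq> 0" "q x \<in> polys V" if "x \<in> set ws" for x
    using Q[OF that] SV by (auto simp: q_def coeffs_in_def)
  \<comment> \<open>A point at which the product is not zero serves all leading coefficients at once.\<close>
  have "(\<Prod>x\<in>set ws. q x) \<noteq> 0" using q(1) by simp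
  moreover have "(\<Prod>x\<in>set ws. q x) \<in> polys V" by (rule is_subring_prod) (use q in auto)
  ultimately obtain c where c: "mpoly_subst (\<lambda>v. mconst (c v)) (\<Prod>x\<in>set ws. q x) \<noteq> (0 :: ('x, 'k) mpoly)"
    using mpoly_nonvanishing_point[OF inf V(1)] by metis
  define e0 :: "('x, 'k) mpoly \<Rightarrow> ('x, 'k) mpoly" where "e0 = mpoly_subst (\<lambda>v. mconst (c v))"
  have e0: "is_hom e0" by (simp add: e0_def is_hom_mpoly_subst)
  have e0q: "e0 (q x) \<noteq> 0" if "x \<in> set ws" for x
  proof
    assume "e0 (q x) = 0"
    have "(\<Prod>x\<in>set ws. q x) = q x * (\<Prod>x\<in>set ws - {x}. q x)"
      using that by (intro prod.remove) auto
    then have "e0 (\<Prod>x\<in>set ws. q x) = 0" by (simp add: is_homD[OF e0] \<open>e0 (q x) = 0\<close>)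
    then show False using c by (simp add: e0_def)
  qed
  define ev :: "nat \<Rightarrow> ('x, 'k) mpoly \<Rightarrow> ('x, 'k) mpoly" where
    "ev k = mpoly_subst (\<lambda>v. if v \<in> set (take k ws) then mpoly_var v else mconst (c v))" for k
  have ev: "is_hom (ev k)" for k by (simp add: ev_def is_hom_mpoly_subst)
  have ev_const: "ev k (mconst a) = mconst a" for k a by (simp add: ev_def)
  have e0_ev: "e0 (ev k p) = e0 p" for k p
    using mpoly_hom_agree[OF is_hom_comp[OF e0 ev[of k]] e0, of UNIV p]
    by (simp add: ev_const) (simp add: e0_def ev_def)
  define P where "P k = {p \<in> subalg F. ev k p = 0}" for k
  have prime: "is_prime_in (subalg F) (P k)" for k
    by (auto simp: is_prime_in_def P_def is_homD[OF ev] is_subringD)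
  have strict: "P (Suc k) \<subset> P k" if k: "k < s" for k
  proof -
    define x where "x = ws ! k"
    have x: "x \<in> set ws" "set (take (Suc k) ws) = insert x (set (take k ws))"
      using k by (auto simp: x_def s_def take_Suc_conv_app_nth)
    have x': "x \<notin> set (take k ws)"
      using k ws(1) unfolding x_def s_def by (metis distinct_take id_take_nth_drop not_distinct_conv_prefix)
    define \<sigma> where "\<sigma> = mpoly_subst (mpoly_var(x := mconst (c x) :: ('x, 'k) mpoly))"
    have \<sigma>: "is_hom \<sigma>" by (simp add: \<sigma>_def is_hom_mpoly_subst)
    have \<sigma>_ev: "\<sigma> (ev (Suc k) p) = ev k p" for p
      using mpoly_hom_agree[OF is_hom_comp[OF \<sigma> ev[of "Suc k"]] ev[of k], of UNIV p] x' x(2)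
      by (simp add: ev_const) (simp add: ev_def \<sigma>_def)
    have sub: "P (Suc k) \<subseteq> P k"
    proof
      fix p assume "p \<in> P (Suc k)"
      then show "p \<in> P k" using \<sigma>_ev[of p] by (simp add: P_def is_homD[OF \<sigma>])
    qed
    moreover have "P (Suc k) \<noteq> P k"
    proof
      assume eq: "P (Suc k) = P k"
      define B where "B = ev (Suc k) ` subalg F"
      have B: "is_subring B" by (simp add: B_def subalg_def is_hom_image[OF ev])
      have const_B: "mconst a \<in> B" for a
        unfolding B_def by (rule image_eqI[of _ _ "mconst a"]) (simp_all add: ev_const mconst_in_subalg)
      have "transcendental B (mpoly_var x)"
      proof (rule transc_if_specialization_inj[where \<sigma> = \<sigma> and c = "mconst (c x)"])
        show "b = 0" if b: "b \<in> B" "\<sigma> b = 0" for b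
        proof -
          obtain a where a: "a \<in> subalg F" "b = ev (Suc k) a" using b(1) by (auto simp: B_def)
          then have "a \<in> P k" using b(2) \<sigma>_ev[of a] by (simp add: P_def)
          then have "a \<in> P (Suc k)" using eq by simp
          then show ?thesis using a by (simp add: P_def)
        qed
      qed (simp_all add: B const_B is_homD[OF \<sigma>] mpoly_var_neq_mconst, simp_all add: \<sigma>_def)
      moreover have "coeffs_in B (map_poly (ev (Suc k)) (Q x))"
      proof -
        \<comment> \<open>The variables in \<open>vs\<close> become constants, so \<open>K[F][vs]\<close> has the same image as \<open>K[F]\<close>.\<close>
        have "ev (Suc k) ` S \<subseteq> B"
          unfolding S_def subalg_def is_hom_image[OF ev]
        proof (rule ring_gen_least[OF _ B])
          have "ev (Suc k) (mpoly_var v) = mconst (c v)" if "v \<in> set vs" for v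
            using that ws(2) set_take_subset[of "Suc k" ws] by (auto simp: ev_def)
          then show "ev (Suc k) ` (range mconst \<union> (F \<union> mpoly_var ` set vs)) \<subseteq> B"
            by (auto simp: ev_const const_B) (auto simp: B_def subalg_base)
        qed
        then show ?thesis using Q(1)[OF x(1)]
          by (auto simp: coeffs_in_def coeff_map_poly is_homD[OF ev])
      qed
      moreover have "poly (map_poly (ev (Suc k)) (Q x)) (mpoly_var x) = 0"
      proof -
        have "ev (Suc k) (mpoly_var x) = mpoly_var x" using x(2) by (simp add: ev_def)
        then show ?thesis
          using is_hom_poly[OF ev, of "Suc k" "Q x" "mpoly_var x"] Q(2)[OF x(1)]
          by (simp add: is_homD[OF ev])
      qed
      ultimately have "map_poly (ev (Suc k)) (Q x) = 0" by (rule transcD)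
      then have "ev (Suc k) (q x) = 0"
        unfolding q_def using coeff_map_poly[of "ev (Suc k)" "Q x" "Polynomial.degree (Q x)"]
        by (simp add: is_homD[OF ev])
      then show False using e0_ev[of "Suc k" "q x"] e0q[OF x(1)] by (simp add: is_homD[OF e0])
    qed
    ultimately show ?thesis by auto
  qed
  have "P (s - i) \<subset> P (s - Suc i)" if "i < s" for i
    using strict[of "s - Suc i"] that by (simp add: Suc_diff_Suc)
  then show ?thesis
    unfolding s[symmetric] using prime by (intro exI[of _ "\<lambda>i. P (s - i)"]) simp
qed

theorem krull_dim_subalg:
  fixes F :: "('x::linorder, 'k::field) mpoly set"
  assumes "infinite (UNIV :: 'k set)" "finite V" "F \<subseteq> polys V" "var_basis V F vs"
  shows "krull_dim (ring_of (subalg F)) = enat (card V - length vs)"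
proof (rule antisym)
  show "krull_dim (ring_of (subalg F)) \<le> enat (card V - length vs)"
    unfolding krull_dim_def
  proof (rule Sup_least, clarify)
    fix n and P :: "nat \<Rightarrow> ('x, 'k) mpoly set"
    assume "\<forall>i\<le>n. primeideal (P i) (ring_of (subalg F))" "\<forall>i<n. P i \<subset> P (Suc i)"
    then show "enat n \<le> enat (card V - length vs)"
      using prime_chain_le[OF assms(2-4), of n P] by (simp add: primeideal_ring_of)
  qed
  show "enat (card V - length vs) \<le> krull_dim (ring_of (subalg F))"
    unfolding krull_dim_def using prime_chain_exists[OF assms]
    by (intro Sup_upper CollectI exI[of _ "card V - length vs"]) (simp add: primeideal_ring_of)
qed

text \<open>
  Each variable in \<open>W\<close> is transcendental over the polynomials in \<open>V\<close> and the other variables of \<open>W\<close>, so it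
  can be exchanged with \<open>x\<close>.
\<close>

lemma transc_adjoin_vars:
  fixes F :: "('x::linorder, 'k::field) mpoly set"
  assumes inf: "infinite (UNIV :: 'k set)" and V: "finite W" "V \<inter> W = {}"
    and F: "F \<subseteq> polys V" "x \<in> polys V" and x: "transcendental (subalg F) x"
  shows "transcendental (subalg (F \<union> mpoly_var ` W)) x"
proof -
  obtain ws where ws: "distinct ws" "set ws = W" using finite_distinct_list V(1) by metis
  have "transcendental (ring_gen ((range mconst \<union> F) \<union> set (map mpoly_var ws))) x"
  proof (rule transc_adjoin)
    show "transcendental (ring_gen (range mconst \<union> F)) x" using x by (simp add: subalg_def)
    fix ys' ys'' and y :: "('x, 'k) mpoly" assume "map mpoly_var ws = ys' @ y # ys''"
    then obtain us u us' where us: "ws = us @ u # us'" "y = mpoly_var u" "ys'' = map mpoly_var us'"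
      by (auto simp: map_eq_append_conv map_eq_Cons_conv)
    have "u \<notin> V \<union> set us'" using us(1) ws V(2) by auto
    then have "transcendental (polys (V \<union> set us')) y" unfolding us(2) by (rule transc_mpoly_var[OF inf])
    moreover have "ring_gen (insert x (range mconst \<union> F \<union> set ys'')) \<subseteq> polys (V \<union> set us')"
      using F polys_mono[of V "V \<union> set us'"] us(3)
      by (intro ring_gen_least) (auto intro: mpoly_var_in_polys)
    ultimately show "transcendental (ring_gen (insert x (range mconst \<union> F \<union> set ys''))) y"
      by (rule transc_mono)
  qed
  then show ?thesis using ws(2) by (simp add: subalg_def Un_assoc)
qed

lemma indep_adjoin_vars:
  fixes F :: "('x::linorder, 'k::field) mpoly set"
  assumes inf: "infinite (UNIV :: 'k set)" and V: "finite W" "V \<inter> W = {}"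
    and F: "F \<subseteq> polys V" "set xs \<subseteq> polys V" and x: "alg_indep (range mconst \<union> F) xs"
  shows "alg_indep (range mconst \<union> (F \<union> mpoly_var ` W)) xs"
  using F(2) x
proof (induction xs)
  case (Cons x xs)
  have "transcendental (subalg ((F \<union> set xs) \<union> mpoly_var ` W)) x"
    by (rule transc_adjoin_vars[OF inf V]) (use Cons.prems F in \<open>auto simp: subalg_def Un_assoc\<close>)
  then show ?case using Cons by (simp add: subalg_def ac_simps)
qed simp

lemma indep_append: "alg_indep F (xs @ ys) \<longleftrightarrow> alg_indep (F \<union> set ys) xs \<and> alg_indep F ys"
  by (induction xs) (auto simp: ac_simps)

text \<open>
  Independence of \<open>vs1\<close> over \<open>F1\<close> persists when all variables of \<open>V2\<close> are adjoined, and these generate \<open>F2\<close>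
  and \<open>vs2\<close>; the same holds with the roles exchanged. Maximality is inherited because an equation
  over a ring is an equation over any larger ring.
\<close>

lemma var_basis_Un:
  fixes F1 F2 :: "('x::linorder, 'k::field) mpoly set"
  assumes inf: "infinite (UNIV :: 'k set)" and V: "finite V1" "finite V2" "V1 \<inter> V2 = {}"
    and F: "F1 \<subseteq> polys V1" "F2 \<subseteq> polys V2" and vs: "var_basis V1 F1 vs1" "var_basis V2 F2 vs2"
  shows "var_basis (V1 \<union> V2) (F1 \<union> F2) (vs1 @ vs2)"
  unfolding var_basis_def
proof (intro conjI ballI)
  show "distinct (vs1 @ vs2)" "set (vs1 @ vs2) \<subseteq> V1 \<union> V2"
    using vs V(3) by (auto simp: var_basis_def)
  have sub: "F1 \<union> G \<subseteq> subalg (F1 \<union> mpoly_var ` V2)" if "G \<subseteq> polys V2" for G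
    using that subalg_mono[of "mpoly_var ` V2" "F1 \<union> mpoly_var ` V2"]
    by (auto simp: polys_subalg intro: subalg_base)
  have sub': "F2 \<union> G \<subseteq> subalg (F2 \<union> mpoly_var ` V1)" if "G \<subseteq> polys V1" for G
    using that subalg_mono[of "mpoly_var ` V1" "F2 \<union> mpoly_var ` V1"]
    by (auto simp: polys_subalg intro: subalg_base)
  have "alg_indep (range mconst \<union> (F1 \<union> mpoly_var ` V2)) (map mpoly_var vs1)"
    using vs(1) by (intro indep_adjoin_vars[OF inf V(2,3) F(1)])
      (auto simp: var_basis_def intro: mpoly_var_in_polys)
  note * = indep_append_smaller[OF this, of "range mconst \<union> (F1 \<union> F2) \<union> mpoly_var ` set vs2" "[]"]
  have 1: "alg_indep (range mconst \<union> (F1 \<union> F2) \<union> set (map mpoly_var vs2)) (map mpoly_var vs1)"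
  proof -
    have "F1 \<union> (F2 \<union> mpoly_var ` set vs2) \<subseteq> subalg (F1 \<union> mpoly_var ` V2)"
      by (rule sub) (use F(2) vs(2) in \<open>auto simp: var_basis_def intro: mpoly_var_in_polys\<close>)
    then show ?thesis using * by (simp add: subalg_def[symmetric] image_subset_iff mconst_in_subalg)
  qed
  have "alg_indep (range mconst \<union> (F2 \<union> mpoly_var ` V1)) (map mpoly_var vs2)"
    using vs(2) V(3) by (intro indep_adjoin_vars[OF inf V(1) _ F(2)])
      (auto simp: var_basis_def intro: mpoly_var_in_polys)
  from indep_append_smaller[OF this, of "range mconst \<union> (F1 \<union> F2)" "[]"]
  have 2: "alg_indep (range mconst \<union> (F1 \<union> F2)) (map mpoly_var vs2)"
    using sub'[OF F(1)] by (simp add: subalg_def[symmetric] image_subset_iff mconst_in_subalg)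
  show "alg_indep (range mconst \<union> (F1 \<union> F2)) (map mpoly_var (vs1 @ vs2))"
    using 1 2 by (simp add: indep_append)
  fix x assume x: "x \<in> V1 \<union> V2 - set (vs1 @ vs2)"
  have m1: "subalg (F1 \<union> mpoly_var ` set vs1) \<subseteq> subalg (F1 \<union> F2 \<union> mpoly_var ` set (vs1 @ vs2))"
    by (rule subalg_mono) auto
  have m2: "subalg (F2 \<union> mpoly_var ` set vs2) \<subseteq> subalg (F1 \<union> F2 \<union> mpoly_var ` set (vs1 @ vs2))"
    by (rule subalg_mono) auto
  show "\<not> transcendental (subalg (F1 \<union> F2 \<union> mpoly_var ` set (vs1 @ vs2))) (mpoly_var x)"
  proof
    assume t: "transcendental (subalg (F1 \<union> F2 \<union> mpoly_var ` set (vs1 @ vs2))) (mpoly_var x)"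
    show False using transc_mono[OF t m1] transc_mono[OF t m2] x vs
      by (auto simp: var_basis_def)
  qed
qed

lemma var_basis_length_le: "finite V \<Longrightarrow> var_basis V F vs \<Longrightarrow> length vs \<le> card V"
  using distinct_card[of vs] card_mono[of V "set vs"] by (simp add: var_basis_def)

lemma krull_dim_subalg_Un:
  fixes F1 F2 :: "('x::linorder, 'k::field) mpoly set"
  assumes inf: "infinite (UNIV :: 'k set)" and V: "finite V1" "finite V2" "V1 \<inter> V2 = {}"
    and F: "F1 \<subseteq> polys V1" "F2 \<subseteq> polys V2"
  shows "krull_dim (ring_of (subalg (F1 \<union> F2))) =
    krull_dim (ring_of (subalg F1)) + krull_dim (ring_of (subalg F2))"
proof -
  obtain vs1 vs2 where vs: "var_basis V1 F1 vs1" "var_basis V2 F2 vs2"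
    using var_basis_exists V by metis
  have "F1 \<union> F2 \<subseteq> polys (V1 \<union> V2)"
    using F polys_mono[of V1 "V1 \<union> V2"] polys_mono[of V2 "V1 \<union> V2"] by auto
  then have "krull_dim (ring_of (subalg (F1 \<union> F2))) = enat (card (V1 \<union> V2) - length (vs1 @ vs2))"
    using V by (intro krull_dim_subalg[OF inf _ _ var_basis_Un[OF inf V F vs]]) auto
  then show ?thesis
    using krull_dim_subalg[OF inf V(1) F(1) vs(1)] krull_dim_subalg[OF inf V(2) F(2) vs(2)]
      var_basis_length_le[OF V(1) vs(1)] var_basis_length_le[OF V(2) vs(2)] V
    by (simp add: card_Un_disjoint)
qed

theorem krull_dim_subalg_UN:
  fixes F :: "'i \<Rightarrow> ('x::linorder, 'k::field) mpoly set"
  assumes inf: "infinite (UNIV :: 'k set)" and "finite I" "\<And>i. i \<in> I \<Longrightarrow> finite (V i)"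
    "\<And>i. i \<in> I \<Longrightarrow> F i \<subseteq> polys (V i)" "disjoint_family_on V I"
  shows "krull_dim (ring_of (subalg (\<Union>i\<in>I. F i))) = (\<Sum>i\<in>I. krull_dim (ring_of (subalg (F i))))"
  using assms(2-)
proof (induction I)
  case empty
  have "var_basis {} ({} :: ('x, 'k) mpoly set) []" by (simp add: var_basis_def)
  from krull_dim_subalg[OF inf _ _ this] show ?case by (simp add: zero_enat_def)
next
  case (insert i I)
  have "(\<Union>i\<in>I. F i) \<subseteq> polys (\<Union>i\<in>I. V i)"
    using insert.prems(2) polys_mono[of "V _" "\<Union>i\<in>I. V i"] by fast
  moreover have "V i \<inter> (\<Union>i\<in>I. V i) = {}"
    using insert.prems(3) insert.hyps(2) by (force simp: disjoint_family_on_def)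
  ultimately have "krull_dim (ring_of (subalg (F i \<union> (\<Union>i\<in>I. F i)))) =
    krull_dim (ring_of (subalg (F i))) + krull_dim (ring_of (subalg (\<Union>i\<in>I. F i)))"
    using insert.prems insert.hyps(1) by (intro krull_dim_subalg_Un[OF inf, of "V i" "\<Union>i\<in>I. V i"]) auto
  moreover have "disjoint_family_on V I"
    using insert.prems(3) by (auto simp: disjoint_family_on_def)
  ultimately show ?case using insert by simp
qed

section \<open>The fiber ring of an ideal generated in one degree\<close>

text \<open>
  The substitution \<open>x \<mapsto> x t\<close> for all variables \<open>x\<close>; the coefficient of \<open>t\<^sup>n\<close> is the homogeneous component
  of degree \<open>n\<close>. In this form multiplicativity of the grading needs no separate argument.
\<close>

definition grading :: "('x, 'k::field) mpoly \<Rightarrow> ('x, 'k) mpoly poly" where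
  "grading = mpoly_eval (\<lambda>c. [:mconst c:]) (\<lambda>v. Polynomial.monom (mpoly_var v) 1)"

lemma is_hom_grading_consts: "is_hom (\<lambda>c. [:mconst c:])"
  by (simp add: is_hom_def mconst_simps one_pCons)

lemma is_hom_grading: "is_hom grading"
  unfolding grading_def by (rule is_hom_mpoly_eval[OF is_hom_grading_consts])

lemmas grading_simps = is_homD[OF is_hom_grading]

lemma grading_mconst: "grading (mconst c) = [:mconst c:]"
  unfolding grading_def by (rule mpoly_eval_mconst[OF is_hom_grading_consts])

lemma grading_var: "grading (mpoly_var v) = Polynomial.monom (mpoly_var v) 1"
  unfolding grading_def by (rule mpoly_eval_var[OF is_hom_grading_consts])

definition component :: "nat \<Rightarrow> ('x, 'k::field) mpoly \<Rightarrow> ('x, 'k) mpoly" where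
  "component n p = Polynomial.coeff (grading p) n"

definition homogeneous :: "nat \<Rightarrow> ('x, 'k::field) mpoly \<Rightarrow> bool" where
  "homogeneous n p \<longleftrightarrow> grading p = Polynomial.monom p n"

lemma homogeneous_0: "homogeneous n 0"
  by (simp add: homogeneous_def grading_simps)

lemma homogeneous_add: "homogeneous n p \<Longrightarrow> homogeneous n q \<Longrightarrow> homogeneous n (p + q)"
  by (simp add: homogeneous_def grading_simps add_monom)

lemma homogeneous_diff: "homogeneous n p \<Longrightarrow> homogeneous n q \<Longrightarrow> homogeneous n (p - q)"
  by (simp add: homogeneous_def grading_simps diff_monom)

lemma homogeneous_mult: "homogeneous m p \<Longrightarrow> homogeneous n q \<Longrightarrow> homogeneous (m + n) (p * q)"
  by (simp add: homogeneous_def grading_simps mult_monom)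

lemma homogeneous_mconst: "homogeneous 0 (mconst c)"
  by (simp add: homogeneous_def grading_mconst monom_0)

lemma homogeneous_var: "homogeneous 1 (mpoly_var v)"
  by (simp add: homogeneous_def grading_var)

lemma homogeneous_sum: "(\<And>i. i \<in> I \<Longrightarrow> homogeneous n (f i)) \<Longrightarrow> homogeneous n (sum f I)"
  by (induction I rule: infinite_finite_induct) (auto intro: homogeneous_0 homogeneous_add)

lemma component_homogeneous: "homogeneous n p \<Longrightarrow> component m p = (if m = n then p else 0)"
  by (auto simp: homogeneous_def component_def)

lemma component_0 [simp]: "component n 0 = 0"
  by (simp add: component_def grading_simps)

lemma component_add: "component n (p + q) = component n p + component n q"
  by (simp add: component_def grading_simps)

lemma component_diff: "component n (p - q) = component n p - component n q"
  by (simp add: component_def grading_simps)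

lemma component_sum: "component n (sum f I) = (\<Sum>i\<in>I. component n (f i))"
  by (induction I rule: infinite_finite_induct) (simp_all add: component_add)

lemma homogeneous_component: "homogeneous n (component n p)"
proof -
  have "p \<in> ring_gen (range mconst \<union> range mpoly_var)"
    using in_polys_UNIV[of p] by (simp add: polys_def)
  then have "\<forall>n. homogeneous n (component n p)"
  proof induction
    case (base x)
    then consider c where "x = mconst c" | v where "x = mpoly_var v" by auto
    then obtain d where "homogeneous d x"
    proof cases
      case 1
      then show ?thesis using that[of 0] by (simp add: homogeneous_mconst)
    next
      case 2
      then show ?thesis by (intro that[of 1]) (simp only: homogeneous_var)
    qed
    then show ?case by (simp add: component_homogeneous homogeneous_0)
  next
    case one
    have "homogeneous 0 1" using homogeneous_mconst[of 1] by (simp add: mconst_simps)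
    then show ?case by (simp add: component_homogeneous[OF \<open>homogeneous 0 1\<close>] homogeneous_0)
  next
    case (uminus x)
    have "component n (- x) = - component n x" for n by (simp add: component_def grading_simps)
    then show ?case
      using uminus homogeneous_diff[OF homogeneous_0, of _ "component _ x"] by simp
  next
    case (add x y)
    then show ?case by (auto simp: component_add intro: homogeneous_add)
  next
    case (mult x y)
    have "component n (x * y) = (\<Sum>i\<le>n. component i x * component (n - i) y)" for n
      by (simp add: component_def grading_simps coeff_mult)
    moreover have "homogeneous n (component i x * component (n - i) y)" if "i \<le> n" for i n
      using homogeneous_mult[of i "component i x" "n - i" "component (n - i) y"] mult that by simp
    ultimately show ?case by (auto intro!: homogeneous_sum)
  qed
  then show ?thesis by blast
qed

definition order_ge :: "nat \<Rightarrow> ('x, 'k::field) mpoly \<Rightarrow> bool" where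
  "order_ge n p \<longleftrightarrow> (\<forall>i<n. component i p = 0)"

text \<open>
  Components of lowest possible degree multiply, as in the associated graded ring of a filtration.
\<close>

lemma component_mult_order_ge:
  assumes "order_ge m p" "order_ge n q"
  shows "component (m + n) (p * q) = component m p * component n q" "order_ge (m + n) (p * q)"
proof -
  have c: "component l (p * q) = (\<Sum>i\<le>l. component i p * component (l - i) q)" for l
    by (simp add: component_def grading_simps coeff_mult)
  have "component i p * component (m + n - i) q = (if i = m then component m p * component n q else 0)"
    if "i \<le> m + n" for i
  proof (cases i m rule: linorder_cases)
    case less
    then show ?thesis using assms(1) by (simp add: order_ge_def)
  next
    case greater
    then have "m + n - i < n" using that by linarith
    then show ?thesis using greater assms(2) by (simp add: order_ge_def)
  qed simp
  then show "component (m + n) (p * q) = component m p * component n q"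
    unfolding c by simp
  have "component i p * component (l - i) q = 0" if "l < m + n" "i \<le> l" for l i
  proof (cases "i < m")
    case True
    then show ?thesis using assms(1) by (simp add: order_ge_def)
  next
    case False
    then have "l - i < n" using that by linarith
    then show ?thesis using assms(2) by (simp add: order_ge_def)
  qed
  then show "order_ge (m + n) (p * q)" by (auto simp: order_ge_def c intro!: sum.neutral)
qed

lemma order_ge_add: "order_ge n p \<Longrightarrow> order_ge n q \<Longrightarrow> order_ge n (p + q)"
  by (simp add: order_ge_def component_add)

lemma order_ge_0 [simp]: "order_ge 0 p" by (simp add: order_ge_def)

lemma order_ge_homogeneous: "homogeneous n p \<Longrightarrow> order_ge n p"
  by (simp add: order_ge_def component_homogeneous)

lemma finsum_ring_of:
  assumes "is_subring S" "finite A" "\<And>i. i \<in> A \<Longrightarrow> f i \<in> S"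
  shows "finsum (ring_of S) f A = sum f A"
  using assms(2,3)
proof (induction A)
  case empty
  interpret cring "ring_of S" by (rule cring_ring_of[OF assms(1)])
  show ?case using finsum_empty[of f] by simp
next
  case (insert x A)
  interpret cring "ring_of S" by (rule cring_ring_of[OF assms(1)])
  have "finsum (ring_of S) f (insert x A) = f x \<oplus>\<^bsub>ring_of S\<^esub> finsum (ring_of S) f A"
    using insert by (intro finsum_insert) auto
  then show ?case using insert by simp
qed

definition is_ideal_in :: "'a::comm_ring_1 set \<Rightarrow> 'a set \<Rightarrow> bool" where
  "is_ideal_in S I \<longleftrightarrow> I \<subseteq> S \<and> 0 \<in> I \<and> (\<forall>x\<in>I. \<forall>y\<in>I. x + y \<in> I) \<and> (\<forall>r\<in>S. \<forall>x\<in>I. r * x \<in> I)"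

lemma is_ideal_inD:
  assumes "is_ideal_in S I"
  shows "I \<subseteq> S" "0 \<in> I" "x \<in> I \<Longrightarrow> y \<in> I \<Longrightarrow> x + y \<in> I" "r \<in> S \<Longrightarrow> x \<in> I \<Longrightarrow> r * x \<in> I"
  using assms by (simp_all add: is_ideal_in_def)

lemma ideal_ring_of:
  assumes S: "is_subring S" shows "ideal I (ring_of S) \<longleftrightarrow> is_ideal_in S I"
proof
  assume "ideal I (ring_of S)"
  then interpret I: ideal I "ring_of S" .
  show "is_ideal_in S I"
    unfolding is_ideal_in_def
  proof (intro conjI ballI)
    show "I \<subseteq> S" using I.a_subset by simp
    show "0 \<in> I" using additive_subgroup.zero_closed[OF I.additive_subgroup_axioms] by simp
    show "x + y \<in> I" if "x \<in> I" "y \<in> I" for x y using additive_subgroup.a_closed[OF I.additive_subgroup_axioms that] by simp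
    show "r * x \<in> I" if "r \<in> S" "x \<in> I" for r x using I.I_l_closed[of x r] that by simp
  qed
next
  assume I: "is_ideal_in S I"
  interpret cring "ring_of S" by (rule cring_ring_of[OF S])
  have neg: "- x \<in> I" if "x \<in> I" for x
    using is_ideal_inD(4)[OF I, of "- 1" x] that is_subringD(1,2)[OF S] by simp
  have sub: "x \<in> S" if "x \<in> I" for x using is_ideal_inD(1)[OF I] that by auto
  have sg: "subgroup I (add_monoid (ring_of S))"
  proof (rule group.subgroupI)
    show "Group.group (add_monoid (ring_of S))" by (rule a_group)
    show "I \<noteq> {}" using is_ideal_inD(2)[OF I] by auto
    fix a assume a: "a \<in> I"
    show "inv\<^bsub>add_monoid (ring_of S)\<^esub> a \<in> I"
      using a_inv_ring_of[OF S sub[OF a]] neg[OF a] by (simp add: a_inv_def)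
  qed (use sub is_ideal_inD(3)[OF I] in auto)
  show "ideal I (ring_of S)"
  proof (rule idealI[OF ring_axioms sg])
    fix a x assume "a \<in> I" "x \<in> carrier (ring_of S)"
    then have "x * a \<in> I" using is_ideal_inD(4)[OF I] by simp
    then show "x \<otimes>\<^bsub>ring_of S\<^esub> a \<in> I" "a \<otimes>\<^bsub>ring_of S\<^esub> x \<in> I" by (simp_all add: mult.commute)
  qed
qed

text \<open>
  Preimages of primes under a surjection are primes, and they are distinct for distinct primes.
\<close>

lemma krull_dim_surj_le:
  assumes "ring_hom_ring A B h" "cring A" "h ` carrier A = carrier B"
  shows "krull_dim B \<le> krull_dim A"
  unfolding krull_dim_def
proof (rule Sup_mono, clarify)
  fix n P assume P: "\<forall>i\<le>n. primeideal (P i) B" "\<forall>i<n. P i \<subset> P (Suc i)"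
  let ?Q = "\<lambda>i. {r \<in> carrier A. h r \<in> P i}"
  have "primeideal (?Q i) A" if "i \<le> n" for i
    using ring_hom_ring.primeideal_vimage[OF assms(1,2)] P(1) that by blast
  moreover have "?Q i \<subset> ?Q (Suc i)" if i: "i < n" for i
  proof -
    obtain x where x: "x \<in> P (Suc i)" "x \<notin> P i" using P(2) i by blast
    have "primeideal (P (Suc i)) B" using P(1) i by simp
    then have "x \<in> carrier B" using x(1) by (meson ideal.Icarr primeideal.axioms(1))
    then obtain r where "r \<in> carrier A" "h r = x" using assms(3) by (metis imageE)
    then have "r \<in> ?Q (Suc i)" "r \<notin> ?Q i" using x by auto
    moreover have "?Q i \<subseteq> ?Q (Suc i)" using P(2) i by auto
    ultimately show ?thesis by blast
  qed
  ultimately show "\<exists>a\<in>{enat n |n. \<exists>P. (\<forall>i\<le>n. primeideal (P i) A) \<and> (\<forall>i<n. P i \<subset> P (Suc i))}. enat n \<le> a"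
    by (intro bexI[of _ "enat n"] CollectI exI[of _ n] exI[of _ ?Q] conjI allI impI) auto
qed

lemma krull_dim_iso_le:
  assumes "cring A" "cring B" "A \<simeq> B" shows "krull_dim B \<le> krull_dim A"
proof -
  obtain h where h: "h \<in> ring_iso A B" using assms(3) by (auto simp: is_ring_iso_def)
  then have "h \<in> ring_hom A B" "h ` carrier A = carrier B"
    by (auto simp: ring_iso_def bij_betw_def)
  moreover have "ring A" "ring B" using assms by (simp_all add: cring.axioms(1))
  ultimately show ?thesis
    using krull_dim_surj_le[of A B h] assms(1) by (simp add: ring_hom_ringI2)
qed

lemma krull_dim_iso:
  assumes "cring A" "cring B" "A \<simeq> B" shows "krull_dim A = krull_dim B"
  using krull_dim_iso_le[OF assms] ring_iso_sym[OF cring.axioms(1)[OF assms(1)] assms(3)]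
    krull_dim_iso_le[OF assms(2,1)] by simp

lemma order_ge_zero: "order_ge n 0"
  by (simp add: order_ge_def)

text \<open>
  With generators of one degree \<open>d\<close>, the elements of degree \<open>k d\<close> in the \<open>k\<close>-th power of the ideal represent all
  elements of degree \<open>k\<close> of the fiber ring, and they do so without repetition. As \<open>d\<close> is positive, the
  degree \<open>k d\<close> determines \<open>k\<close>.
\<close>

locale equigenerated =
  fixes V :: "'x set" and F :: "('x, 'k::field) mpoly set" and d :: nat
  assumes F_polys: "F \<subseteq> polys V" and F_hom: "f \<in> F \<Longrightarrow> homogeneous d f" and d_pos: "0 < d"
begin

abbreviation R where "R \<equiv> ring_of (polys V :: ('x, 'k) mpoly set)"

definition I where "I = Idl\<^bsub>R\<^esub> F"

definition ideal_power where "ideal_power k = I [^]\<^bsub>ideals_set R\<^esub> (k::nat)"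

definition rees where "rees = rees_algebra R I"

definition fiber_ideal where "fiber_ideal = Idl\<^bsub>rees\<^esub> ((\<lambda>a. up_ring.monom (UP R) a 0) ` irrelevant_ideal V)"

lemma cring_R: "cring R"
  by (rule cring_ring_of) simp

lemma ring_R: "ring R"
  by (rule cring.axioms(1)[OF cring_R])

lemma genideal_R_least:
  assumes "is_ideal_in (polys V) fiber_null" "G \<subseteq> fiber_null" shows "Idl\<^bsub>R\<^esub> G \<subseteq> fiber_null"
  using assms by (intro ring.genideal_minimal[OF ring_R]) (simp_all add: ideal_ring_of)

lemma ideal_I: "ideal I R"
  unfolding I_def by (rule ring.genideal_ideal[OF ring_R]) (simp add: F_polys)

lemma F_subset_I: "F \<subseteq> I"
  unfolding I_def by (rule ring.genideal_self[OF ring_R]) (simp add: F_polys)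

lemma ideal_power_0: "ideal_power 0 = polys V"
  by (simp add: ideal_power_def ideals_set_def)

lemma ideal_power_Suc: "ideal_power (Suc k) = ideal_prod R (ideal_power k) I"
  by (simp add: ideal_power_def ideals_set_def)

lemma ideal_ideal_power: "ideal (ideal_power k) R"
proof (induction k)
  case 0
  show ?case using ring.oneideal[OF ring_R] by (simp add: ideal_power_0)
next
  case (Suc k)
  show ?case unfolding ideal_power_Suc by (rule ring.ideal_prod_is_ideal[OF ring_R Suc ideal_I])
qed

lemma is_ideal_in_ideal_power: "is_ideal_in (polys V) (ideal_power k)"
  using ideal_ideal_power[of k] by (simp add: ideal_ring_of)

lemmas ideal_power_closed = is_ideal_inD[OF is_ideal_in_ideal_power]

lemma ideal_power_polys: "x \<in> ideal_power k \<Longrightarrow> x \<in> polys V"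
  using ideal_power_closed(1) by blast

lemma sum_closed_ideal_power: "(\<And>i. i \<in> A \<Longrightarrow> f i \<in> ideal_power k) \<Longrightarrow> sum f A \<in> ideal_power k"
  by (induction A rule: infinite_finite_induct) (auto intro: ideal_power_closed)

lemma ideal_power_mult:
  assumes "x \<in> ideal_power k" "y \<in> ideal_power l" shows "x * y \<in> ideal_power (k + l)"
proof -
  interpret cm: comm_monoid "ideals_set R" by (rule cring.ideals_set_is_comm_monoid[OF cring_R])
  have "I \<in> carrier (ideals_set R)" using ideal_I by (simp add: ideals_set_def)
  then have "ideal_power (k + l) = ideal_prod R (ideal_power k) (ideal_power l)"
    unfolding ideal_power_def by (subst cm.nat_pow_mult[symmetric]) (simp_all add: ideals_set_def)
  then show ?thesis using ideal_prod.prod[OF assms, of R] by simp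
qed

lemma I_ideal_power_1: "I = ideal_power 1"
proof -
  interpret cm: comm_monoid "ideals_set R" by (rule cring.ideals_set_is_comm_monoid[OF cring_R])
  have "I \<in> carrier (ideals_set R)" using ideal_I by (simp add: ideals_set_def)
  then show ?thesis by (simp add: ideal_power_def)
qed

lemma I_order_ge: "x \<in> I \<Longrightarrow> order_ge d x"
proof -
  have "is_ideal_in (polys V) {x \<in> polys V. order_ge d x}"
    unfolding is_ideal_in_def
    using component_mult_order_ge(2)[OF order_ge_0, of d]
    by (auto simp: is_subringD order_ge_add order_ge_zero)
  then have "I \<subseteq> {x \<in> polys V. order_ge d x}"
    unfolding I_def by (rule genideal_R_least) (use F_polys F_hom order_ge_homogeneous in auto)
  then show "x \<in> I \<Longrightarrow> order_ge d x" by auto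
qed

lemma ideal_power_order_ge: "x \<in> ideal_power k \<Longrightarrow> order_ge (k * d) x"
proof (induction k arbitrary: x)
  case (Suc k)
  from Suc.prems[unfolded ideal_power_Suc] show ?case
  proof (induction rule: ideal_prod.induct)
    case (prod i j)
    then show ?case
      using component_mult_order_ge(2)[OF Suc.IH[OF prod(1)] I_order_ge[OF prod(2)]]
      by (simp add: add.commute)
  next
    case (sum s1 s2)
    then show ?case by (simp add: order_ge_add)
  qed
qed simp

lemma UP_cring_R: "UP_cring R"
  by (rule UP_cring.intro[OF cring_R])

lemma carrier_UP_R:
  "carrier (UP R) = {p. (\<forall>k. p k \<in> polys V) \<and> (\<exists>n. \<forall>k>n. p k = 0)}"
  by (auto simp: UP_def up_def bound_def)

lemma coeff_UP_R: "p \<in> carrier (UP R) \<Longrightarrow> up_ring.coeff (UP R) p k = p k"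
  by (simp add: UP_def)

lemma carrier_rees:
  "carrier rees = {p. (\<forall>k. p k \<in> ideal_power k) \<and> (\<exists>n. \<forall>k>n. p k = 0)}"
proof -
  have "carrier rees = {p \<in> carrier (UP R). \<forall>k. p k \<in> ideal_power k}"
    by (auto simp: rees_def rees_algebra_def coeff_UP_R ideal_power_def)
  then show ?thesis using ideal_power_polys by (auto simp: carrier_UP_R)
qed

lemma rees_subset_UP: "carrier rees \<subseteq> carrier (UP R)"
  unfolding carrier_UP_R carrier_rees using ideal_power_polys by auto

lemma rees_ops:
  "\<one>\<^bsub>rees\<^esub> = (\<lambda>i. if i = 0 then 1 else 0)" "\<zero>\<^bsub>rees\<^esub> = (\<lambda>i. 0)"
  "p \<in> carrier rees \<Longrightarrow> q \<in> carrier rees \<Longrightarrow> p \<oplus>\<^bsub>rees\<^esub> q = (\<lambda>i. p i + q i)"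
  "p \<in> carrier rees \<Longrightarrow> q \<in> carrier rees \<Longrightarrow> p \<otimes>\<^bsub>rees\<^esub> q = (\<lambda>n. \<Sum>i\<le>n. p i * q (n - i))"
proof -
  show "\<one>\<^bsub>rees\<^esub> = (\<lambda>i. if i = 0 then 1 else 0)" "\<zero>\<^bsub>rees\<^esub> = (\<lambda>i. 0)"
    by (simp_all add: rees_def rees_algebra_def UP_def cong: if_cong)
  assume pq: "p \<in> carrier rees" "q \<in> carrier rees"
  then have up: "p \<in> up R" "q \<in> up R" using rees_subset_UP by (auto simp: UP_def)
  show "p \<oplus>\<^bsub>rees\<^esub> q = (\<lambda>i. p i + q i)"
    using up by (simp add: rees_def rees_algebra_def UP_def)
  have "finsum R (\<lambda>i. p i * q (n - i)) {..n} = (\<Sum>i\<le>n. p i * q (n - i))" for n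
    using mem_upD[OF up(1)] mem_upD[OF up(2)] by (intro finsum_ring_of) (auto intro: is_subringD)
  then show "p \<otimes>\<^bsub>rees\<^esub> q = (\<lambda>n. \<Sum>i\<le>n. p i * q (n - i))"
    using up by (simp add: rees_def rees_algebra_def UP_def)
qed

lemma cring_rees: "cring rees"
proof -
  interpret UP_cring R "UP R" by (rule UP_cring_R)
  have eq: "rees = (UP R)\<lparr>carrier := carrier rees\<rparr>"
    by (simp add: rees_def rees_algebra_def)
  have ops: "x \<otimes>\<^bsub>UP R\<^esub> y = x \<otimes>\<^bsub>rees\<^esub> y" "x \<oplus>\<^bsub>UP R\<^esub> y = x \<oplus>\<^bsub>rees\<^esub> y" for x y
    by (simp_all add: rees_def rees_algebra_def)
  have "subring (carrier rees) (UP R)"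
  proof (rule P.subringI[OF rees_subset_UP])
    have "(\<lambda>i. if i = 0 then 1 else 0) \<in> carrier rees"
      using ideal_power_closed(2) by (auto simp: carrier_rees ideal_power_0 is_subringD)
    then show "\<one>\<^bsub>UP R\<^esub> \<in> carrier rees" by (simp add: UP_def cong: if_cong)
  next
    fix h assume h: "h \<in> carrier rees"
    then have h': "h \<in> carrier (UP R)" using rees_subset_UP by auto
    have "(\<ominus>\<^bsub>UP R\<^esub> h) k = - h k" for k
      using coeff_a_inv[OF h', of k] UP_a_inv_closed[OF h'] h'
      by (simp add: coeff_UP_R a_inv_ring_of carrier_UP_R)
    moreover have "- h k \<in> ideal_power k" for k
      using h ideal_power_closed(4)[of "- 1" "h k" k] by (simp add: carrier_rees is_subringD)
    ultimately show "\<ominus>\<^bsub>UP R\<^esub> h \<in> carrier rees"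
      using h by (auto simp: carrier_rees)
  next
    fix p q assume pq: "p \<in> carrier rees" "q \<in> carrier rees"
    obtain m n where mn: "\<And>k. m < k \<Longrightarrow> p k = 0" "\<And>k. n < k \<Longrightarrow> q k = 0"
      using pq by (auto simp: carrier_rees)
    have "\<exists>n. \<forall>k>n. p k + q k = 0" by (rule exI[of _ "max m n"]) (use mn in auto)
    then show "p \<oplus>\<^bsub>UP R\<^esub> q \<in> carrier rees"
      unfolding ops rees_ops(3)[OF pq] using pq by (auto simp: carrier_rees intro: ideal_power_closed)
    have "p i * q (k - i) \<in> ideal_power k" if "i \<le> k" for i k
      using ideal_power_mult[of "p i" i "q (k - i)" "k - i"] pq that by (simp add: carrier_rees)
    then have "(\<Sum>i\<le>k. p i * q (k - i)) \<in> ideal_power k" for k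
      by (intro sum_closed_ideal_power) auto
    moreover have "(\<Sum>i\<le>k. p i * q (k - i)) = 0" if "m + n < k" for k
    proof (intro sum.neutral ballI)
      fix i assume "i \<in> {..k}"
      then have "m < i \<or> n < k - i" using that by auto
      then show "p i * q (k - i) = 0" using mn by auto
    qed
    ultimately show "p \<otimes>\<^bsub>UP R\<^esub> q \<in> carrier rees"
      unfolding ops rees_ops(4)[OF pq] by (auto simp: carrier_rees)
  qed
  then show ?thesis
    using P.subcring_iff[OF rees_subset_UP] P.subcringI' eq by simp
qed

lemma ring_rees: "ring rees"
  by (rule cring.axioms(1)[OF cring_rees])

text \<open>
  The element \<open>a t\<^sup>n\<close> of the Rees algebra.
\<close>

definition mon :: "('x, 'k) mpoly \<Rightarrow> nat \<Rightarrow> nat \<Rightarrow> ('x, 'k) mpoly" where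
  "mon a n = (\<lambda>i. if i = n then a else 0)"

lemma mon_in_rees: "a \<in> ideal_power n \<Longrightarrow> mon a n \<in> carrier rees"
  using ideal_power_closed(2) by (auto simp: carrier_rees mon_def)

lemma mon_add: "a \<in> ideal_power n \<Longrightarrow> b \<in> ideal_power n \<Longrightarrow> mon a n \<oplus>\<^bsub>rees\<^esub> mon b n = mon (a + b) n"
  by (subst rees_ops(3)) (auto simp: mon_in_rees, auto simp: mon_def)

lemma mon_mult:
  assumes "a \<in> ideal_power m" "b \<in> ideal_power n"
  shows "mon a m \<otimes>\<^bsub>rees\<^esub> mon b n = mon (a * b) (m + n)"
proof -
  have "(\<Sum>i\<le>l. mon a m i * mon b n (l - i)) = mon (a * b) (m + n) l" for l
  proof -
    have "(\<Sum>i\<le>l. mon a m i * mon b n (l - i)) = (\<Sum>i\<le>l. if i = m then (if l - m = n then a * b else 0) else 0)"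
      by (intro sum.cong refl) (auto simp: mon_def)
    also have "\<dots> = mon (a * b) (m + n) l" by (auto simp: mon_def)
    finally show ?thesis .
  qed
  then show ?thesis using assms by (subst rees_ops(4)) (auto simp: mon_in_rees)
qed

lemma M_polys: "irrelevant_ideal V \<subseteq> (polys V :: ('x, 'k) mpoly set)"
  and var_in_M: "v \<in> V \<Longrightarrow> mpoly_var v \<in> (irrelevant_ideal V :: ('x, 'k) mpoly set)"
  and M_order_ge: "a \<in> (irrelevant_ideal V :: ('x, 'k) mpoly set) \<Longrightarrow> order_ge 1 a"
proof -
  have sub: "mpoly_var ` V \<subseteq> (carrier R :: ('x, 'k) mpoly set)" by (auto intro: mpoly_var_in_polys)
  have "ideal (irrelevant_ideal V) R"
    unfolding irrelevant_ideal_def mpoly_ring_eq by (rule ring.genideal_ideal[OF ring_R sub])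
  then show "irrelevant_ideal V \<subseteq> (polys V :: ('x, 'k) mpoly set)"
    by (simp add: ideal_ring_of is_ideal_in_def)
  show "v \<in> V \<Longrightarrow> mpoly_var v \<in> (irrelevant_ideal V :: ('x, 'k) mpoly set)"
    unfolding irrelevant_ideal_def mpoly_ring_eq using ring.genideal_self[OF ring_R sub] by auto
  have "is_ideal_in (polys V) {x \<in> polys V :: ('x, 'k) mpoly set. order_ge 1 x}"
    unfolding is_ideal_in_def
    using component_mult_order_ge(2)[OF order_ge_0, of 1]
    by (auto simp: is_subringD order_ge_add order_ge_zero)
  then have "irrelevant_ideal V \<subseteq> {x \<in> polys V :: ('x, 'k) mpoly set. order_ge 1 x}"
    unfolding irrelevant_ideal_def mpoly_ring_eq
    by (rule genideal_R_least)
      (use order_ge_homogeneous[OF homogeneous_var] in \<open>auto intro: mpoly_var_in_polys\<close>)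
  then show "a \<in> (irrelevant_ideal V :: ('x, 'k) mpoly set) \<Longrightarrow> order_ge 1 a" by auto
qed

lemma fiber_ideal_eq: "fiber_ideal = Idl\<^bsub>rees\<^esub> ((\<lambda>a. mon a 0) ` irrelevant_ideal V)"
proof -
  have "up_ring.monom (UP R) a 0 = mon a 0" if "a \<in> irrelevant_ideal V" for a
    using that M_polys by (auto simp: UP_def mon_def)
  then have "(\<lambda>a. up_ring.monom (UP R) a 0) ` irrelevant_ideal V = (\<lambda>a. mon a 0) ` irrelevant_ideal V"
    by (intro image_cong) auto
  then show ?thesis by (simp add: fiber_ideal_def)
qed

lemma gens_in_rees: "(\<lambda>a. mon a 0) ` irrelevant_ideal V \<subseteq> carrier rees"
  using M_polys by (auto simp: ideal_power_0 intro!: mon_in_rees)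

lemma ideal_fiber_ideal: "ideal fiber_ideal rees"
  unfolding fiber_ideal_eq by (rule ring.genideal_ideal[OF ring_rees gens_in_rees])

lemma fiber_ideal_gens: "a \<in> irrelevant_ideal V \<Longrightarrow> mon a 0 \<in> fiber_ideal"
  unfolding fiber_ideal_eq using ring.genideal_self[OF ring_rees gens_in_rees] by auto

text \<open>
  An element of the \<open>k\<close>-th power of the ideal has no components of degree less than \<open>k d\<close>; this map keeps
  only the component of degree \<open>k d\<close> of the coefficient of \<open>t\<^sup>k\<close>, and is a ring homomorphism for this reason.
\<close>

definition initial_forms :: "(nat \<Rightarrow> ('x, 'k) mpoly) \<Rightarrow> ('x, 'k) mpoly poly" where
  "initial_forms p = Abs_poly (\<lambda>k. component (k * d) (p k))"

lemma coeff_initial_forms: "p \<in> carrier rees \<Longrightarrow> Polynomial.coeff (initial_forms p) k = component (k * d) (p k)"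
proof -
  assume "p \<in> carrier rees"
  then obtain n where "\<forall>k>n. p k = 0" by (auto simp: carrier_rees)
  then show ?thesis unfolding initial_forms_def by (subst coeff_Abs_poly[of n]) auto
qed

lemma initial_forms_hom:
  assumes "p \<in> carrier rees" "q \<in> carrier rees"
  shows "initial_forms (p \<otimes>\<^bsub>rees\<^esub> q) = initial_forms p * initial_forms q" "initial_forms (p \<oplus>\<^bsub>rees\<^esub> q) = initial_forms p + initial_forms q" "initial_forms \<one>\<^bsub>rees\<^esub> = 1"
proof -
  interpret rees: cring rees by (rule cring_rees)
  show "initial_forms (p \<oplus>\<^bsub>rees\<^esub> q) = initial_forms p + initial_forms q"
    using coeff_initial_forms[OF rees.a_closed[OF assms]] assms
    by (intro poly_eqI) (simp add: coeff_initial_forms rees_ops component_add)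
  show "initial_forms (p \<otimes>\<^bsub>rees\<^esub> q) = initial_forms p * initial_forms q"
  proof (rule poly_eqI)
    fix n
    have "component (n * d) (p i * q (n - i)) = component (i * d) (p i) * component ((n - i) * d) (q (n - i))"
      if "i \<le> n" for i
    proof -
      have "i * d + (n - i) * d = n * d" using that by (simp add: add_mult_distrib[symmetric])
      then show ?thesis
        using component_mult_order_ge(1)[OF ideal_power_order_ge[of "p i" i] ideal_power_order_ge[of "q (n - i)" "n - i"]] assms
        by (simp add: carrier_rees)
    qed
    then show "Polynomial.coeff (initial_forms (p \<otimes>\<^bsub>rees\<^esub> q)) n = Polynomial.coeff (initial_forms p * initial_forms q) n"
      using coeff_initial_forms[OF rees.m_closed[OF assms]] assms
      by (simp add: coeff_initial_forms rees_ops component_sum coeff_mult)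
  qed
  have c1: "component 0 (1 :: ('x, 'k) mpoly) = 1"
    using component_homogeneous[OF homogeneous_mconst, of 0 1] by (simp add: mconst_simps)
  have "Polynomial.coeff (initial_forms \<one>\<^bsub>rees\<^esub>) k = Polynomial.coeff 1 k" for k
    using coeff_initial_forms[OF rees.one_closed, of k] c1 by (cases k) (auto simp: rees_ops)
  then show "initial_forms \<one>\<^bsub>rees\<^esub> = 1" by (rule poly_eqI)
qed

lemma initial_forms_one: "initial_forms \<one>\<^bsub>rees\<^esub> = 1"
  using initial_forms_hom(3) mon_in_rees[OF ideal_power_closed(2)] by blast

text \<open>
  Elements of the irrelevant ideal have no constant term, so \<open>initial_forms\<close> kills the generators of
  \<open>fiber_ideal\<close>.
\<close>

lemma fiber_ideal_component:
  assumes "p \<in> fiber_ideal" shows "component (k * d) (p k) = 0"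
proof -
  interpret rees: cring rees by (rule cring_rees)
  have "cring (ring_of (UNIV :: ('x, 'k) mpoly poly set))"
    by (rule cring_ring_of) (simp add: is_subring_def)
  then have "ring_hom_ring rees (ring_of UNIV) initial_forms"
    by (intro ring_hom_ringI2 ring_rees ring_hom_memI) (auto simp: initial_forms_hom initial_forms_one cring.axioms(1))
  then have ker: "ideal (a_kernel rees (ring_of UNIV) initial_forms) rees" by (rule ring_hom_ring.kernel_is_ideal)
  have "fiber_ideal \<subseteq> a_kernel rees (ring_of UNIV) initial_forms"
    unfolding fiber_ideal_eq
  proof (rule ring.genideal_minimal[OF ring_rees ker], clarify)
    fix a :: "('x, 'k) mpoly" assume a: "a \<in> irrelevant_ideal V"
    have in_rees: "mon a 0 \<in> carrier rees" using gens_in_rees a by auto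
    have "component 0 a = 0" using M_order_ge[OF a] by (simp add: order_ge_def)
    then have "initial_forms (mon a 0) = 0"
      by (intro poly_eqI) (simp add: coeff_initial_forms[OF in_rees], simp add: mon_def)
    then show "mon a 0 \<in> a_kernel rees (ring_of UNIV) initial_forms" using in_rees by (simp add: a_kernel_def')
  qed
  then have "p \<in> carrier rees" "initial_forms p = 0" using assms by (auto simp: a_kernel_def')
  then show ?thesis using coeff_initial_forms[of p k] by simp
qed

text \<open>
  The part of the \<open>k\<close>-th power of the ideal that becomes zero in degree \<open>k\<close> of the fiber ring.
\<close>

definition fiber_null :: "nat \<Rightarrow> ('x, 'k) mpoly set" where
  "fiber_null k = {q \<in> ideal_power k. mon q k \<in> fiber_ideal}"

lemma fiber_null_0: "0 \<in> fiber_null k"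
proof -
  have "mon 0 k = \<zero>\<^bsub>rees\<^esub>" by (simp add: mon_def rees_ops)
  then show ?thesis
    using additive_subgroup.zero_closed[OF ideal.axioms(1)[OF ideal_fiber_ideal]] ideal_power_closed(2) by (simp add: fiber_null_def)
qed

lemma fiber_null_add: "p \<in> fiber_null k \<Longrightarrow> q \<in> fiber_null k \<Longrightarrow> p + q \<in> fiber_null k"
  using additive_subgroup.a_closed[OF ideal.axioms(1)[OF ideal_fiber_ideal], of "mon p k" "mon q k"]
  by (simp add: fiber_null_def ideal_power_closed mon_add)

lemma fiber_null_mult:
  assumes "p \<in> fiber_null k" "q \<in> ideal_power l" shows "p * q \<in> fiber_null (k + l)"
proof -
  have "mon p k \<otimes>\<^bsub>rees\<^esub> mon q l \<in> fiber_ideal"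
    using assms by (intro ideal.I_r_closed[OF ideal_fiber_ideal]) (auto simp: fiber_null_def mon_in_rees)
  then show ?thesis using assms by (simp add: fiber_null_def mon_mult ideal_power_mult)
qed

lemma fiber_null_component: "q \<in> fiber_null k \<Longrightarrow> component (k * d) q = 0"
  using fiber_ideal_component[of "mon q k" k] by (simp add: fiber_null_def mon_def)

text \<open>
  In degree \<open>k\<close> of the fiber ring, \<open>p\<close> has a representative \<open>h\<close> that is homogeneous of degree \<open>k d\<close> and is
  a polynomial expression in \<open>F\<close>. The following lemmas show that this holds for all \<open>p\<close> in the
  \<open>k\<close>-th power of the ideal.
\<close>

definition has_initial_form :: "nat \<Rightarrow> ('x, 'k) mpoly \<Rightarrow> bool" where
  "has_initial_form k p \<longleftrightarrow> p \<in> ideal_power k \<and>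
     (\<exists>h. homogeneous (k * d) h \<and> h \<in> ideal_power k \<and> h \<in> subalg F \<and> p - h \<in> fiber_null k)"

lemma has_initial_form_add:
  assumes "has_initial_form k p" "has_initial_form k q" shows "has_initial_form k (p + q)"
proof -
  obtain g h where gh: "homogeneous (k * d) g" "g \<in> ideal_power k" "g \<in> subalg F" "p - g \<in> fiber_null k"
    "homogeneous (k * d) h" "h \<in> ideal_power k" "h \<in> subalg F" "q - h \<in> fiber_null k" and pq: "p \<in> ideal_power k" "q \<in> ideal_power k"
    using assms by (auto simp: has_initial_form_def)
  have "p + q - (g + h) = (p - g) + (q - h)" by simp
  then have "p + q - (g + h) \<in> fiber_null k" using fiber_null_add gh by metis
  then show ?thesis unfolding has_initial_form_def
    using gh pq by (intro conjI exI[of _ "g + h"]) (auto intro: homogeneous_add ideal_power_closed is_subringD)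
qed

lemma has_initial_form_mult:
  assumes "has_initial_form k p" "has_initial_form l q" shows "has_initial_form (k + l) (p * q)"
proof -
  obtain g h where gh: "homogeneous (k * d) g" "g \<in> ideal_power k" "g \<in> subalg F" "p - g \<in> fiber_null k"
    "homogeneous (l * d) h" "h \<in> ideal_power l" "h \<in> subalg F" "q - h \<in> fiber_null l" and pq: "p \<in> ideal_power k" "q \<in> ideal_power l"
    using assms by (auto simp: has_initial_form_def)
  have "p * q - g * h = (p - g) * q + (q - h) * g" by (simp add: algebra_simps)
  moreover have "(p - g) * q \<in> fiber_null (k + l)" by (rule fiber_null_mult) fact+
  moreover have "(q - h) * g \<in> fiber_null (k + l)" using fiber_null_mult[OF gh(8,2)] by (simp add: add.commute)
  ultimately have "p * q - g * h \<in> fiber_null (k + l)" using fiber_null_add by simp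
  moreover have "homogeneous ((k + l) * d) (g * h)"
    using homogeneous_mult[OF gh(1,5)] by (simp add: add_mult_distrib)
  ultimately show ?thesis unfolding has_initial_form_def
    using gh pq by (intro conjI exI[of _ "g * h"]) (auto intro: ideal_power_mult is_subringD)
qed

lemma has_initial_form_mconst: "has_initial_form 0 (mconst c)"
  unfolding has_initial_form_def
  by (intro conjI exI[of _ "mconst c"]) (simp_all add: ideal_power_0 homogeneous_mconst mconst_in_subalg fiber_null_0)

text \<open>
  Every polynomial is congruent to its constant term modulo the irrelevant ideal.
\<close>

lemma has_initial_form_poly:
  assumes "p \<in> polys V" shows "has_initial_form 0 p"
  using assms unfolding polys_def
proof induction
  case (base x)
  then consider c where "x = mconst c" | v where "v \<in> V" "x = mpoly_var v" by auto
  then show ?case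
  proof cases
    case 2
    then have x: "x \<in> ideal_power 0" by (simp add: ideal_power_0 mpoly_var_in_polys)
    then have "x \<in> fiber_null 0" using fiber_ideal_gens[OF var_in_M] 2 by (simp add: fiber_null_def)
    then show ?thesis unfolding has_initial_form_def
      using x ideal_power_closed(2)[of 0] is_subringD(5)[OF is_subring_subalg]
      by (intro conjI exI[of _ 0]) (simp_all add: homogeneous_0)
  qed (simp add: has_initial_form_mconst)
next
  case one
  show ?case using has_initial_form_mconst[of 1] by (simp add: mconst_simps)
next
  case (uminus x)
  then show ?case
    using has_initial_form_mult[OF has_initial_form_mconst[of "- 1"], of 0 x] by (simp add: mconst_simps)
next
  case (add x y)
  then show ?case by (simp add: has_initial_form_add)
next
  case (mult x y)
  then show ?case using has_initial_form_mult[of 0 x 0 y] by simp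
qed

lemma has_initial_form_0: "has_initial_form k 0"
  unfolding has_initial_form_def
  using ideal_power_closed(2) is_subringD(5)[OF is_subring_subalg] fiber_null_0
  by (intro conjI exI[of _ 0]) (simp_all add: homogeneous_0)

lemma has_initial_form_I: "p \<in> I \<Longrightarrow> has_initial_form 1 p"
proof -
  have ideal: "is_ideal_in (polys V) {p \<in> polys V. has_initial_form 1 p}"
    unfolding is_ideal_in_def
  proof (intro conjI ballI)
    fix r x :: "('x, 'k) mpoly" assume "r \<in> polys V" "x \<in> {p \<in> polys V. has_initial_form 1 p}"
    then show "r * x \<in> {p \<in> polys V. has_initial_form 1 p}"
      using has_initial_form_mult[OF has_initial_form_poly, of r 1 x] by (simp add: is_subringD)
  qed (auto simp: is_subringD has_initial_form_add has_initial_form_0)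
  have "has_initial_form 1 f" if f: "f \<in> F" for f
  proof -
    have "f \<in> ideal_power 1" using F_subset_I f by (auto simp: I_ideal_power_1)
    then show ?thesis unfolding has_initial_form_def
      using f F_hom by (intro conjI exI[of _ f]) (simp_all add: subalg_base fiber_null_0)
  qed
  then have "I \<subseteq> {p \<in> polys V. has_initial_form 1 p}"
    unfolding I_def using F_polys by (intro genideal_R_least[OF ideal]) auto
  then show "p \<in> I \<Longrightarrow> has_initial_form 1 p" by auto
qed

lemma has_initial_form_ideal_power: "p \<in> ideal_power k \<Longrightarrow> has_initial_form k p"
proof (induction k arbitrary: p)
  case 0
  then show ?case by (simp add: has_initial_form_poly ideal_power_0)
next
  case (Suc k)
  from Suc.prems[unfolded ideal_power_Suc] show ?case
  proof (induction rule: ideal_prod.induct)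
    case (prod i j)
    then show ?case using has_initial_form_mult[OF Suc.IH has_initial_form_I] by simp
  next
    case (sum s1 s2)
    then show ?case by (simp add: has_initial_form_add)
  qed
qed

text \<open>
  The representative \<open>h\<close> is unique: it is the component of degree \<open>k d\<close>.
\<close>

lemma component_ideal_power:
  assumes "p \<in> ideal_power k"
  shows "component (k * d) p \<in> subalg F" "p - component (k * d) p \<in> fiber_null k"
proof -
  obtain h where h: "homogeneous (k * d) h" "h \<in> subalg F" "p - h \<in> fiber_null k"
    using has_initial_form_ideal_power[OF assms] by (auto simp: has_initial_form_def)
  have "component (k * d) p = component (k * d) h"
    using fiber_null_component[OF h(3)] by (simp add: component_diff)
  then have "component (k * d) p = h" using h(1) by (simp add: component_homogeneous)
  then show "component (k * d) p \<in> subalg F" "p - component (k * d) p \<in> fiber_null k" using h by simp_all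
qed

text \<open>
  Setting \<open>t = 1\<close> in \<open>initial_forms p\<close> loses nothing, since the coefficients of different powers of \<open>t\<close> are
  homogeneous of different degrees.
\<close>

definition fiber_map where "fiber_map p = poly (initial_forms p) 1"

lemma fiber_map_in: "p \<in> carrier rees \<Longrightarrow> fiber_map p \<in> subalg F"
  unfolding fiber_map_def
  by (rule coeffs_in_poly)
    (auto simp: coeffs_in_def coeff_initial_forms carrier_rees component_ideal_power is_subringD)

lemma ring_hom_fiber_map: "ring_hom_ring rees (ring_of (subalg F)) fiber_map"
proof (intro ring_hom_ringI2 ring_rees ring_hom_memI)
  show "ring (ring_of (subalg F))" by (rule cring.axioms(1)[OF cring_ring_of]) simp
  interpret rees: cring rees by (rule cring_rees)
  show "fiber_map \<one>\<^bsub>rees\<^esub> = \<one>\<^bsub>ring_of (subalg F)\<^esub>"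
    using initial_forms_hom(3)[OF rees.one_closed rees.one_closed] by (simp add: fiber_map_def)
qed (simp_all add: fiber_map_in, simp_all add: fiber_map_def initial_forms_hom)

lemma fiber_map_surj: "fiber_map ` carrier rees = subalg F"
proof
  show "fiber_map ` carrier rees \<subseteq> subalg F" using fiber_map_in by auto
  interpret h: ring_hom_ring rees "ring_of (subalg F)" fiber_map by (rule ring_hom_fiber_map)
  have mon: "fiber_map (mon a k) = a" if "a \<in> ideal_power k" "homogeneous (k * d) a" for a k
  proof -
    have "initial_forms (mon a k) = Polynomial.monom a k"
      using coeff_initial_forms[OF mon_in_rees[OF that(1)]] component_homogeneous[OF that(2)]
      by (intro poly_eqI) (auto simp: mon_def)
    then show ?thesis by (simp add: fiber_map_def poly_monom)
  qed
  show "subalg F \<subseteq> fiber_map ` carrier rees"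
    unfolding subalg_def
  proof (rule ring_gen_least)
    show "range mconst \<union> F \<subseteq> fiber_map ` carrier rees"
    proof
      fix x assume "x \<in> range mconst \<union> F"
      then obtain k where "x \<in> ideal_power k" "homogeneous (k * d) x"
      proof
        assume "x \<in> range mconst"
        then show ?thesis by (intro that[of 0]) (auto simp: ideal_power_0 homogeneous_mconst)
      next
        assume "x \<in> F"
        then show ?thesis using F_hom F_subset_I by (intro that[of 1]) (auto simp: I_ideal_power_1)
      qed
      then show "x \<in> fiber_map ` carrier rees" using mon mon_in_rees by (metis imageI)
    qed
    show "is_subring (fiber_map ` carrier rees)"
      unfolding is_subring_def
    proof (intro conjI ballI)
      show "1 \<in> fiber_map ` carrier rees" using h.hom_one by (intro image_eqI[of _ _ "\<one>\<^bsub>rees\<^esub>"]) auto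
      fix x assume "x \<in> fiber_map ` carrier rees"
      then obtain a where a: "a \<in> carrier rees" "x = fiber_map a" by auto
      show "- x \<in> fiber_map ` carrier rees"
        using a h.hom_a_inv[OF a(1)] fiber_map_in[OF a(1)]
        by (intro image_eqI[of _ _ "\<ominus>\<^bsub>rees\<^esub> a"]) (auto simp: a_inv_ring_of)
      fix y assume "y \<in> fiber_map ` carrier rees"
      then obtain b where b: "b \<in> carrier rees" "y = fiber_map b" by auto
      show "x + y \<in> fiber_map ` carrier rees"
        using a b by (intro image_eqI[of _ _ "a \<oplus>\<^bsub>rees\<^esub> b"]) auto
      show "x * y \<in> fiber_map ` carrier rees"
        using a b by (intro image_eqI[of _ _ "a \<otimes>\<^bsub>rees\<^esub> b"]) auto
    qed
  qed
qed

text \<open>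
  If all initial forms of \<open>p\<close> are zero, then each coefficient of \<open>p\<close> lies in \<open>fiber_null\<close>, and \<open>p\<close> is the sum of
  its terms.
\<close>

lemma kernel_fiber_map: "a_kernel rees (ring_of (subalg F)) fiber_map = fiber_ideal"
proof
  show "fiber_ideal \<subseteq> a_kernel rees (ring_of (subalg F)) fiber_map"
  proof
    fix p assume p: "p \<in> fiber_ideal"
    then have "p \<in> carrier rees" using ideal.Icarr[OF ideal_fiber_ideal] by blast
    moreover from this have "initial_forms p = 0" using fiber_ideal_component[OF p] by (intro poly_eqI) (simp add: coeff_initial_forms)
    ultimately show "p \<in> a_kernel rees (ring_of (subalg F)) fiber_map" by (simp add: a_kernel_def' fiber_map_def)
  qed
  show "a_kernel rees (ring_of (subalg F)) fiber_map \<subseteq> fiber_ideal"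
  proof
    fix p assume "p \<in> a_kernel rees (ring_of (subalg F)) fiber_map"
    then have p: "p \<in> carrier rees" and 0: "fiber_map p = 0" by (auto simp: a_kernel_def')
    obtain n where n: "\<And>k. n < k \<Longrightarrow> p k = 0" using p by (auto simp: carrier_rees)
    \<comment> \<open>Compare the components of degree \<open>k d\<close> in the equation \<open>fiber_map p = 0\<close>; this is where \<open>d > 0\<close> is used.\<close>
    have "component (k * d) (p k) = 0" for k
    proof (cases "k \<le> n")
      case True
      have deg: "Polynomial.degree (initial_forms p) \<le> n"
        using n by (intro degree_le) (simp add: coeff_initial_forms[OF p])
      have "0 = component (k * d) (\<Sum>i\<le>n. component (i * d) (p i))"
        using 0 poly_as_sum[OF deg, of 1] by (simp add: fiber_map_def coeff_initial_forms[OF p])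
      also have "\<dots> = (\<Sum>i\<le>n. if i = k then component (k * d) (p k) else 0)"
        unfolding component_sum using d_pos
        by (intro sum.cong refl) (simp add: component_homogeneous[OF homogeneous_component])
      also have "\<dots> = component (k * d) (p k)" using True by simp
      finally show ?thesis by simp
    qed (use n in simp)
    then have mon_fiber_ideal: "mon (p k) k \<in> fiber_ideal" for k
      using component_ideal_power(2)[of "p k" k] p by (simp add: fiber_null_def carrier_rees)
    have trunc: "(\<lambda>i. if i < m then p i else 0) \<in> fiber_ideal" for m
    proof (induction m)
      case 0
      then show ?case
        using additive_subgroup.zero_closed[OF ideal.axioms(1)[OF ideal_fiber_ideal]] by (simp add: rees_ops)
    next
      case (Suc m)
      have "(\<lambda>i. if i < m then p i else 0) \<oplus>\<^bsub>rees\<^esub> mon (p m) m \<in> fiber_ideal"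
        using Suc mon_fiber_ideal by (rule additive_subgroup.a_closed[OF ideal.axioms(1)[OF ideal_fiber_ideal]])
      also have "(\<lambda>i. if i < m then p i else 0) \<oplus>\<^bsub>rees\<^esub> mon (p m) m = (\<lambda>i. if i < Suc m then p i else 0)"
        using Suc mon_fiber_ideal ideal.Icarr[OF ideal_fiber_ideal]
        by (subst rees_ops(3)) (auto simp: mon_def less_Suc_eq)
      finally show ?case .
    qed
    have "(\<lambda>i. if i < Suc n then p i else 0) = p" using n by (auto simp: not_less_eq)
    then show "p \<in> fiber_ideal" using trunc[of "Suc n"] by simp
  qed
qed

theorem analytic_spread_eq_krull_dim:
  "analytic_spread V (Idl\<^bsub>mpoly_ring V\<^esub> F) = krull_dim (ring_of (subalg F))"
proof -
  have "special_fiber_ring (mpoly_ring V) (irrelevant_ideal V) I = rees Quot fiber_ideal"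
    by (simp add: special_fiber_ring_def rees_def fiber_ideal_def mpoly_ring_eq)
  moreover have "krull_dim (rees Quot fiber_ideal) = krull_dim (ring_of (subalg F))"
  proof (rule krull_dim_iso)
    show "cring (rees Quot fiber_ideal)" by (rule ideal.quotient_is_cring[OF ideal_fiber_ideal cring_rees])
    show "cring (ring_of (subalg F))" by (rule cring_ring_of) simp
    show "rees Quot fiber_ideal \<simeq> ring_of (subalg F)"
      using ring_hom_ring.FactRing_iso[OF ring_hom_fiber_map] fiber_map_surj by (simp add: kernel_fiber_map)
  qed
  ultimately show ?thesis by (simp add: analytic_spread_def I_def mpoly_ring_eq)
qed

end

section \<open>Binomial edge ideals and connected components\<close>

text \<open>
  A linear order of the variables orders the monomials, and leading monomials show that the
  polynomials form an integral domain. Any linear order would do.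
\<close>

instantiation bei_var :: (linorder) linorder
begin

fun less_eq_bei_var :: "'a bei_var \<Rightarrow> 'a bei_var \<Rightarrow> bool" where
  "less_eq_bei_var (Xvar a) (Xvar b) \<longleftrightarrow> a \<le> b"
| "less_eq_bei_var (Xvar a) (Yvar b) \<longleftrightarrow> True"
| "less_eq_bei_var (Yvar a) (Xvar b) \<longleftrightarrow> False"
| "less_eq_bei_var (Yvar a) (Yvar b) \<longleftrightarrow> a \<le> b"

definition less_bei_var :: "'a bei_var \<Rightarrow> 'a bei_var \<Rightarrow> bool" where
  "less_bei_var x y \<longleftrightarrow> x \<le> y \<and> \<not> y \<le> x"

instance
proof
  fix x y z :: "'a bei_var"
  show "x < y \<longleftrightarrow> x \<le> y \<and> \<not> y \<le> x" by (rule less_bei_var_def)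
  show "x \<le> x" by (cases x) auto
  show "x \<le> y \<Longrightarrow> y \<le> z \<Longrightarrow> x \<le> z" by (cases x; cases y; cases z) auto
  show "x \<le> y \<Longrightarrow> y \<le> x \<Longrightarrow> x = y" by (cases x; cases y) auto
  show "x \<le> y \<or> y \<le> x" by (cases x; cases y) auto
qed

end

definition edge_binomials :: "('v, 'e) pre_digraph \<Rightarrow> ('v bei_var, 'k::field) mpoly set" where
  "edge_binomials H =
     {mpoly_var (Xvar i) * mpoly_var (Yvar j) - mpoly_var (Xvar j) * mpoly_var (Yvar i)
      | i j. (i, j) \<in> arcs_ends H}"

lemma edge_binomials_polys:
  assumes "wf_digraph H" shows "edge_binomials H \<subseteq> polys (bei_vars H)"
proof -
  interpret wf_digraph H by fact
  show ?thesis
    by (auto simp: edge_binomials_def arcs_ends_conv bei_vars_def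
        intro!: is_subringD(4,6) mpoly_var_in_polys)
qed

lemma edge_binomials_homogeneous: "f \<in> edge_binomials H \<Longrightarrow> homogeneous 2 f"
proof -
  have "homogeneous 2 (mpoly_var u * mpoly_var v)" for u v :: "'a bei_var"
    using homogeneous_mult[OF homogeneous_var homogeneous_var, of u v] by (simp add: numeral_2_eq_2)
  then show "f \<in> edge_binomials H \<Longrightarrow> homogeneous 2 f"
    by (auto simp: edge_binomials_def intro: homogeneous_diff)
qed

lemma analytic_spread_binomial_edge_ideal:
  assumes "wf_digraph H"
  shows "analytic_spread (bei_vars H) (binomial_edge_ideal H :: ('v bei_var, 'k::field) mpoly set) =
    krull_dim (ring_of (subalg (edge_binomials H :: ('v bei_var, 'k) mpoly set)))"
proof -
  interpret equigenerated "bei_vars H" "edge_binomials H :: ('v bei_var, 'k) mpoly set" 2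
    by unfold_locales (simp_all add: edge_binomials_polys[OF assms] edge_binomials_homogeneous)
  show ?thesis
    using analytic_spread_eq_krull_dim by (simp add: binomial_edge_ideal_def edge_binomials_def)
qed

context graph
begin

definition reach_class :: "'a \<Rightarrow> 'a set" where
  "reach_class v = {u. v \<rightarrow>\<^sup>* u}"

lemma reach_class_sccs_verts: "v \<in> verts G \<Longrightarrow> reach_class v \<in> sccs_verts"
proof -
  assume v: "v \<in> verts G"
  then have "v \<in> reach_class v" by (simp add: reach_class_def)
  then show ?thesis
    unfolding in_sccs_verts_conv_reachable reach_class_def
    by (auto intro: reachable_trans symmetric_reachable')
qed

lemma reach_class_subset: "reach_class v \<subseteq> verts G"
  by (auto simp: reach_class_def dest: reachable_in_verts)

lemma connected_reach_class:
  assumes "v \<in> verts G" shows "Digraph_Component.connected (G \<restriction> reach_class v)"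
proof -
  interpret max_reachable_set G "reach_class v"
    using reach_class_sccs_verts[OF assms] by unfold_locales
  interpret K: wf_digraph "G \<restriction> reach_class v" by (rule wellformed_induce_subgraph)
  show ?thesis
    using strongly_connected not_empty by (intro K.connectedI K.reachable_mk_symmetricI) auto
qed

lemma connected_subgraph_verts:
  assumes H: "subgraph H G" "Digraph_Component.connected H" and v: "v \<in> verts H"
  shows "verts H \<subseteq> reach_class v"
proof
  fix u assume u: "u \<in> verts H"
  have sub: "symcl (arcs_ends H) \<subseteq> arcs_ends G"
    using arcs_ends_mono[OF H(1)] arcs_ends_symmetric[OF sym_arcs] by (auto simp: symcl_def)
  have "(v, u) \<in> rtrancl_on (verts H) (symcl (arcs_ends H))"
    using H(2) u v by (simp add: connected_conv)
  then have "(v, u) \<in> rtrancl_on (verts G) (arcs_ends G)"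
    using sub H(1) by (rule_tac rtrancl_on_mono[rotated 2]) auto
  then show "u \<in> reach_class v" by (simp add: reach_class_def reachable_def)
qed

lemma connected_subgraph_of_class:
  assumes H: "subgraph H G" "Digraph_Component.connected H" and v: "v \<in> verts H"
  shows "subgraph H (G \<restriction> reach_class v)"
proof -
  have sub: "verts H \<subseteq> reach_class v" by (rule connected_subgraph_verts[OF H v])
  have "subgraph H (G \<restriction> verts H)" by (rule subgraph_induce_subgraphI2[OF H(1)])
  then show ?thesis using sub H(1)
    by (auto simp: subgraph_def compatible_def)
qed

text \<open>
  The class of all vertices reachable from \<open>v\<close> induces a connected subgraph, and a connected subgraph
  through \<open>v\<close> lies in this class.
\<close>

lemma connected_components_eq: "connected_components G = (\<lambda>v. G \<restriction> reach_class v) ` verts G"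
proof
  show "connected_components G \<subseteq> (\<lambda>v. G \<restriction> reach_class v) ` verts G"
  proof
    fix H assume "H \<in> connected_components G"
    then have max: "max_subgraph Digraph_Component.connected H" by (simp add: connected_components_def)
    then have H: "subgraph H G" "Digraph_Component.connected H" by (simp_all add: max_subgraph_def)
    obtain v where v: "v \<in> verts H" using H(2) by (auto simp: connected_conv)
    then have vG: "v \<in> verts G" using H(1) by auto
    have "subgraph (G \<restriction> reach_class v) G"
      using reach_class_subset by (intro induced_imp_subgraph induced_induce)
    then have "H = G \<restriction> reach_class v"
      using max connected_subgraph_of_class[OF H v] connected_reach_class[OF vG]
      by (auto simp: max_subgraph_def)
    then show "H \<in> (\<lambda>v. G \<restriction> reach_class v) ` verts G" using vG by blast
  qed
  show "(\<lambda>v. G \<restriction> reach_class v) ` verts G \<subseteq> connected_components G"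
  proof clarify
    fix v assume v: "v \<in> verts G"
    have sub: "subgraph (G \<restriction> reach_class v) G"
      using reach_class_subset by (intro induced_imp_subgraph induced_induce)
    have "max_subgraph Digraph_Component.connected (G \<restriction> reach_class v)"
    proof (rule max_subgraphI)
      show "Digraph_Component.connected (G \<restriction> reach_class v)" by (rule connected_reach_class[OF v])
      show "subgraph (G \<restriction> reach_class v) G" by (rule sub)
      fix H assume H: "G \<restriction> reach_class v \<noteq> H" "subgraph (G \<restriction> reach_class v) H" "subgraph H G"
      show "\<not> Digraph_Component.connected H"
      proof
        assume conn: "Digraph_Component.connected H"
        have "v \<in> reach_class v" using v by (simp add: reach_class_def)
        then have "v \<in> verts H" using H(2) by (auto simp: subgraph_def)
        from connected_subgraph_of_class[OF H(3) conn this] H(2)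
        have "verts H = verts (G \<restriction> reach_class v)" "arcs H = arcs (G \<restriction> reach_class v)"
          "tail H = tail (G \<restriction> reach_class v)" "head H = head (G \<restriction> reach_class v)"
          by (auto simp: subgraph_def compatible_def)
        then have "H = G \<restriction> reach_class v" by (intro pre_digraph.equality) simp_all
        then show False using H(1) by simp
      qed
    qed
    then show "G \<restriction> reach_class v \<in> connected_components G" by (simp add: connected_components_def)
  qed
qed

lemma finite_connected_components: "finite (connected_components G)"
  by (simp add: connected_components_eq)

lemma component_wf_finite:
  assumes "H \<in> connected_components G" shows "wf_digraph H" "finite (verts H)"
proof -
  obtain v where v: "H = G \<restriction> reach_class v" using assms by (auto simp: connected_components_eq)
  show "wf_digraph H" unfolding v by (rule wellformed_induce_subgraph)
  show "finite (verts H)" unfolding v using finite_subset[OF reach_class_subset finite_verts] by simp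
qed

lemma components_disjoint:
  assumes "H \<in> connected_components G" "K \<in> connected_components G" "H \<noteq> K"
  shows "verts H \<inter> verts K = {}"
proof (rule ccontr)
  obtain v w where vw: "H = G \<restriction> reach_class v" "K = G \<restriction> reach_class w"
    using assms by (auto simp: connected_components_eq)
  assume "verts H \<inter> verts K \<noteq> {}"
  then obtain u where u: "v \<rightarrow>\<^sup>* u" "w \<rightarrow>\<^sup>* u" using vw by (auto simp: reach_class_def)
  then have "v \<rightarrow>\<^sup>* w" "w \<rightarrow>\<^sup>* v" using symmetric_reachable' reachable_trans by metis+
  then have "reach_class v = reach_class w" unfolding reach_class_def using reachable_trans by blast
  then show False using assms(3) vw by simp
qed

lemma arcs_ends_components: "arcs_ends G = (\<Union>H\<in>connected_components G. arcs_ends H)"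
proof
  show "arcs_ends G \<subseteq> (\<Union>H\<in>connected_components G. arcs_ends H)"
  proof
    fix p assume "p \<in> arcs_ends G"
    then obtain e where e: "e \<in> arcs G" "p = (tail G e, head G e)" by (auto simp: arcs_ends_conv)
    define v where "v = tail G e"
    have v: "v \<in> verts G" using e by (simp add: v_def)
    have "v \<rightarrow>\<^bsub>G\<^esub> head G e" using e in_arcs_imp_in_arcs_ends[OF e(1)] by (simp add: v_def)
    then have "v \<in> reach_class v" "head G e \<in> reach_class v" using v by (auto simp: reach_class_def)
    then have "e \<in> arcs (G \<restriction> reach_class v)" using e by (simp add: v_def)
    then have "p \<in> arcs_ends (G \<restriction> reach_class v)" using e(2) by (force simp: arcs_ends_conv)
    then show "p \<in> (\<Union>H\<in>connected_components G. arcs_ends H)"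
      using v by (auto simp: connected_components_eq)
  qed
  show "(\<Union>H\<in>connected_components G. arcs_ends H) \<subseteq> arcs_ends G"
    by (auto simp: connected_components_eq arcs_ends_conv)
qed

end

theorem theorem3p1:
  fixes G :: "(nat, 'e) pre_digraph"
  assumes "infinite (UNIV :: 'k::field set)"
    and "graph G"
    and "\<forall>v \<in> verts G. 0 < v"
  shows "analytic_spread (bei_vars G) (binomial_edge_ideal G :: (nat bei_var, 'k) mpoly set) =
    (\<Sum>H \<in> connected_components G.
       analytic_spread (bei_vars H) (binomial_edge_ideal H :: (nat bei_var, 'k) mpoly set))"
proof -
  interpret graph G by fact
  let ?F = "edge_binomials :: (nat, 'e) pre_digraph \<Rightarrow> (nat bei_var, 'k) mpoly set"
  have "?F G = (\<Union>H\<in>connected_components G. ?F H)"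
    unfolding edge_binomials_def arcs_ends_components by blast
  then have "analytic_spread (bei_vars G) (binomial_edge_ideal G :: (nat bei_var, 'k) mpoly set) =
      krull_dim (ring_of (subalg (\<Union>H\<in>connected_components G. ?F H)))"
    using analytic_spread_binomial_edge_ideal[OF wf_digraph_axioms, where 'k = 'k] by simp
  also have "\<dots> = (\<Sum>H\<in>connected_components G. krull_dim (ring_of (subalg (?F H))))"
  proof (rule krull_dim_subalg_UN[OF assms(1) finite_connected_components])
    show "finite (bei_vars H)" if "H \<in> connected_components G" for H
      using component_wf_finite(2)[OF that] by (simp add: bei_vars_def)
    show "?F H \<subseteq> polys (bei_vars H)" if "H \<in> connected_components G" for H
      by (rule edge_binomials_polys[OF component_wf_finite(1)[OF that]])
    show "disjoint_family_on bei_vars (connected_components G)"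
      unfolding disjoint_family_on_def
    proof (intro ballI impI)
      fix H K assume "H \<in> connected_components G" "K \<in> connected_components G" "H \<noteq> K"
      from components_disjoint[OF this] show "bei_vars H \<inter> bei_vars K = {}"
        by (auto simp: bei_vars_def)
    qed
  qed
  also have "\<dots> = (\<Sum>H\<in>connected_components G. 
       analytic_spread (bei_vars H) (binomial_edge_ideal H :: (nat bei_var, 'k) mpoly set))"
    by (intro sum.cong refl, rule analytic_spread_binomial_edge_ideal[symmetric],
        rule component_wf_finite(1))
  finally show ?thesis .
qed

end
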